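(* Let $n\ge 1$, let $\Omega_1,\dots,\Omega_n$ be Polish spaces, $\mathbf\Omega=\prod_{i=1}^n\Omega_i$, and $\mathbf c=(c_1,\dots,c_n)\in\mathbb R_+^n$. Let $f:\mathbf\Omega\to\mathbb R$ be a (measurable) $\mathbf c$-Lipschitz function, let $G$ be a graph with vertex set $[n]$, and let $\mathbf X=(X_1,\dots,X_n)$ be a $G$-dependent $\mathbf\Omega$-valued random vector. If $G$ is a disjoint union of trees $T_1,\dots,T_k$, then for every $t>0$, $$\mathbb P\left(f(\mathbf X)-\mathbb E[f(\mathbf X)]\ge t\right)\le \exp\left(-\frac{2t^2}{\sum_{i=1}^k c_{\min,i}^2+\sum_{\{i,j\}\in E(G)}(c_i+c_j)^2}\right),$$ where $c_{\min,i}:=\min\{c_j: j\in V(T_i)\}$ for all $i\in[k]$.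
   Context: $[n]=\{1,\dots,n\}$; $\mathbb R_+$ is the set of non-negative reals. Graphs are finite, undirected and simple; $V(G)$ and $E(G)$ are the vertex and edge sets. A tree is a connected acyclic graph (a single vertex is a tree); the disjoint union of trees $T_1,\dots,T_k$ is a forest whose connected components are exactly $T_1,\dots,T_k$. $X_i$ takes values in $\Omega_i$. A function $f:\mathbf\Omega\to\mathbb R$ is $\mathbf c$-Lipschitz if $|f(\mathbf x)-f(\mathbf x')|\le\sum_{i=1}^n c_i\mathbf 1_{\{x_i\ne x_i'\}}$ for all $\mathbf x=(x_1,\dots,x_n),\mathbf x'=(x_1',\dots,x_n')\in\mathbf\Omega$. A random vector $\mathbf X=(X_i)_{i\in V}$ is $G$-dependent, for a graph $G=(V,E)$, if for any disjoint $S,T\subset V$ that are non-adjacent in $G$ (no edge in $E$ has one endpoint in $S$ and the other in $T$), the families $\{X_i\}_{i\in S}$ and $\{X_j\}_{j\in T}$ are independent. *)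

theory Defs
  imports "HOL-Probability.Probability"
begin

record 'v ugraph =
  verts :: "'v set"
  edges :: "'v set set"

definition simple_graph :: "'v ugraph \<Rightarrow> bool" where
  "simple_graph G \<longleftrightarrow> finite (verts G) \<and>
     (\<forall>e\<in>edges G. \<exists>u\<in>verts G. \<exists>v\<in>verts G. u \<noteq> v \<and> e = {u, v})"

definition walk :: "'v ugraph \<Rightarrow> 'v list \<Rightarrow> bool" where
  "walk G p \<longleftrightarrow> p \<noteq> [] \<and> set p \<subseteq> verts G \<and>
     (\<forall>i. Suc i < length p \<longrightarrow> {p ! i, p ! Suc i} \<in> edges G)"

definition connected_graph :: "'v ugraph \<Rightarrow> bool" where
  "connected_graph G \<longleftrightarrow> verts G \<noteq> {} \<and>
     (\<forall>u\<in>verts G. \<forall>v\<in>verts G. \<exists>p. walk G p \<and> hd p = u \<and> last p = v)"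

text \<open>A cycle is given by the list of its distinct vertices; the closing edge joins the last
  vertex to the first.\<close>

definition graph_cycle :: "'v ugraph \<Rightarrow> 'v list \<Rightarrow> bool" where
  "graph_cycle G p \<longleftrightarrow> walk G p \<and> distinct p \<and> 3 \<le> length p \<and> {last p, hd p} \<in> edges G"

definition acyclic_graph :: "'v ugraph \<Rightarrow> bool" where
  "acyclic_graph G \<longleftrightarrow> (\<nexists>p. graph_cycle G p)"

definition tree_graph :: "'v ugraph \<Rightarrow> bool" where
  "tree_graph G \<longleftrightarrow> simple_graph G \<and> connected_graph G \<and> acyclic_graph G"

definition disjoint_union_of :: "'v ugraph \<Rightarrow> 'i set \<Rightarrow> ('i \<Rightarrow> 'v ugraph) \<Rightarrow> bool" where
  "disjoint_union_of G I T \<longleftrightarrow>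
     disjoint_family_on (\<lambda>i. verts (T i)) I \<and>
     verts G = (\<Union>i\<in>I. verts (T i)) \<and> edges G = (\<Union>i\<in>I. edges (T i))"

definition nonadjacent :: "'v ugraph \<Rightarrow> 'v set \<Rightarrow> 'v set \<Rightarrow> bool" where
  "nonadjacent G S T \<longleftrightarrow> (\<forall>u\<in>S. \<forall>v\<in>T. {u, v} \<notin> edges G)"

text \<open>Spaces are abstract topologies whose points form a subset of the carrier type, so that a
  family of different Polish spaces can be given over one type (for instance inside their
  disjoint union).\<close>

definition polish_topology :: "'a topology \<Rightarrow> bool" where
  "polish_topology X \<longleftrightarrow> completely_metrizable_space X \<and> separable_space X"

definition borel_of_topology :: "'a topology \<Rightarrow> 'a measure" where
  "borel_of_topology X = sigma (topspace X) {U. openin X U}"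

definition lipschitz_wrt ::
  "'i set \<Rightarrow> ('i \<Rightarrow> 'a set) \<Rightarrow> ('i \<Rightarrow> real) \<Rightarrow> (('i \<Rightarrow> 'a) \<Rightarrow> real) \<Rightarrow> bool" where
  "lipschitz_wrt I A c f \<longleftrightarrow>
     (\<forall>x\<in>Pi\<^sub>E I A. \<forall>x'\<in>Pi\<^sub>E I A. \<bar>f x - f x'\<bar> \<le> (\<Sum>i\<in>I. c i * of_bool (x i \<noteq> x' i)))"

definition graph_dependent ::
  "'w measure \<Rightarrow> 'i ugraph \<Rightarrow> ('i \<Rightarrow> 'a measure) \<Rightarrow> ('w \<Rightarrow> 'i \<Rightarrow> 'a) \<Rightarrow> bool" where
  "graph_dependent M G N X \<longleftrightarrow>
     (\<forall>S T. S \<subseteq> verts G \<and> T \<subseteq> verts G \<and> S \<inter> T = {} \<and> nonadjacent G S T \<longrightarrow>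
        prob_space.indep_var M
          (Pi\<^sub>M S N) (\<lambda>\<omega>. restrict (X \<omega>) S)
          (Pi\<^sub>M T N) (\<lambda>\<omega>. restrict (X \<omega>) T))"

text \<open>The quantity \<open>exp (- 2 * t\<^sup>2 / D)\<close> for \<open>t > 0\<close> and \<open>D \<ge> 0\<close>, read as
  \<open>exp (- \<infinity>) = 0\<close> at \<open>D = 0\<close>; with HOL's convention \<open>x / 0 = 0\<close> it would be \<open>1\<close> there.\<close>

definition exp_bound :: "real \<Rightarrow> real \<Rightarrow> real" where
  "exp_bound t D = (if D = 0 then 0 else exp (- (2 * t\<^sup>2 / D)))"

end

theory Submission
  imports Defs "HOL-Real_Asymp.Real_Asymp"
begin

text \<open>
  Root every tree at a vertex of minimal weight, and reveal the coordinates of \<open>X\<close> with children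
  before their parents. When \<open>X\<^sub>v\<close> is revealed, the only unrevealed neighbour of \<open>v\<close> is its parent
  \<open>p\<close>, and dependence on \<open>G\<close> makes \<open>X\<^sub>v\<close> conditionally independent, given the coordinates revealed
  before, of all unrevealed coordinates other than \<open>X\<^sub>p\<close>: the set \<open>C\<close> of descendants of \<open>v\<close> has no
  neighbour outside \<open>C\<close> other than \<open>p\<close>. If \<open>g\<close> does not depend on the coordinates \<open>v\<close>, \<open>p\<close> and satisfies
  \<open>g \<le> f \<le> g + c\<^sub>v + c\<^sub>p\<close>, the conditional expectation of \<open>g\<close> does not change when \<open>X\<^sub>v\<close> is revealed,
  so the Doob martingale of \<open>f\<close> moves within an interval of length \<open>c\<^sub>v + c\<^sub>p\<close> known beforehand
  (length \<open>c\<^sub>v\<close> at a root), and the Azuma--Hoeffding argument applies.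

  The infimum of \<open>f\<close> over the two coordinates need not be Borel, so \<open>g\<close> is built from measurable
  sets that almost surely agree with projections of sublevel sets of \<open>f\<close>. These exist because the
  law of \<open>X\<close> is tight; neither couplings nor regular conditional distributions are needed.
\<close>

section \<open>Rooting a forest\<close>

text \<open>Each vertex pays the square of its interval length. A non-root pays
  \<open>(c v + c (par v))\<^sup>2\<close>, which is the term of the edge to its parent, so every
  edge is paid for exactly once, at its child end; a root pays only its own square. Any choice of
  roots gives a valid bound, and minimal roots give the stated one. Revealing parents first would
  fail: a vertex with many unrevealed children disturbs all of them at once, and the interval would
  grow with the degree.

  One envelope \<open>g\<close> is enough, because the upper bound is \<open>g\<close> plus a
  constant, which passes through conditional expectations. Conditional independence enters only as
  the statement that the conditional expectation of \<open>g\<close> given the larger sigma-algebra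
  has a version measurable for the smaller one.

  An interval of length d costs a factor exp(l^2 d^2 / 8) in the exponential moment. With D the sum
  of the squared lengths, the Chernoff exponent l^2 D / 8 - l t is minimal at l = 4 t / D, where it
  equals -2 t^2 / D.\<close>

lemma walk_Cons:
  assumes "walk G p" "v \<in> verts G" "{v, hd p} \<in> edges G"
  shows "walk G (v # p)"
proof -
  have "{(v # p) ! i, (v # p) ! Suc i} \<in> edges G" if "Suc i < length (v # p)" for i
    using assms that by (cases i) (auto simp: walk_def hd_conv_nth)
  then show ?thesis
    using assms by (auto simp: walk_def)
qed

lemma walk_ConsD:
  assumes "walk G (v # p)" "p \<noteq> []"
  shows "walk G p" "{v, hd p} \<in> edges G"
proof -
  have *: "{(v # p) ! i, (v # p) ! Suc i} \<in> edges G" if "Suc i < length (v # p)" for i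
    using assms that by (auto simp: walk_def)
  show "walk G p"
    using assms *[of "Suc _"] by (auto simp: walk_def)
  show "{v, hd p} \<in> edges G"
    using *[of 0] assms by (auto simp: hd_conv_nth)
qed

lemma walk_snoc:
  assumes "walk G p" "v \<in> verts G" "{last p, v} \<in> edges G"
  shows "walk G (p @ [v])"
proof -
  have "{(p @ [v]) ! i, (p @ [v]) ! Suc i} \<in> edges G" if "Suc i < length (p @ [v])" for i
  proof (cases "Suc i < length p")
    case False
    then have "i = length p - 1" "p \<noteq> []"
      using that assms by (auto simp: walk_def)
    then show ?thesis
      using assms by (auto simp: last_conv_nth nth_append)
  qed (use assms in \<open>auto simp: walk_def nth_append\<close>)
  then show ?thesis
    using assms by (auto simp: walk_def)
qed

lemma walk_leaves_set:
  "walk G p \<Longrightarrow> hd p \<in> S \<Longrightarrow> last p \<notin> S \<Longrightarrow> \<exists>a\<in>S. \<exists>b\<in>verts G - S. {a, b} \<in> edges G"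
proof (induction p)
  case Nil
  then show ?case by (simp add: walk_def)
next
  case (Cons x p)
  then have "p \<noteq> []" by auto
  note w = walk_ConsD[OF Cons.prems(1) this]
  have "hd p \<in> verts G"
    using w(1) \<open>p \<noteq> []\<close> by (auto simp: walk_def)
  show ?case
  proof (cases "hd p \<in> S")
    case True
    then show ?thesis
      using Cons.IH[OF w(1)] Cons.prems(3) \<open>p \<noteq> []\<close> by simp
  next
    case False
    then show ?thesis
      using w(2) Cons.prems(2) \<open>hd p \<in> verts G\<close> by (intro bexI[of _ x] bexI[of _ "hd p"]) auto
  qed
qed

text \<open>A vertex set is grown from the root one vertex at a time. A new vertex \<open>v\<close>
  attaches by a single edge: two neighbours of \<open>v\<close> in the set, joined by a simple path
  inside the set, would close a cycle through \<open>v\<close>. Connectedness lets every proper good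
  set grow, so one of largest cardinality is the whole tree.\<close>

lemma tree_rooting:
  assumes T: "tree_graph T" and r: "r \<in> verts T"
  obtains par and rank :: "'v \<Rightarrow> nat"
  where "\<And>v. v \<in> verts T - {r} \<Longrightarrow> par v \<in> verts T \<and> rank (par v) < rank v"
    and "edges T = (\<lambda>v. {v, par v}) ` (verts T - {r})"
proof -
  have fin: "finite (verts T)"
    and edge: "\<And>e. e \<in> edges T \<Longrightarrow> \<exists>u\<in>verts T. \<exists>v\<in>verts T. u \<noteq> v \<and> e = {u, v}"
    and conn: "\<And>u v. u \<in> verts T \<Longrightarrow> v \<in> verts T \<Longrightarrow> \<exists>p. walk T p \<and> hd p = u \<and> last p = v"
    and acyc: "\<And>p. \<not> graph_cycle T p"
    using T by (auto simp: tree_graph_def simple_graph_def connected_graph_def acyclic_graph_def)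
  \<comment> \<open>Only edges inside \<open>S\<close> are described, which at
    \<open>S = verts T\<close> are all edges. Paths in \<open>joined\<close> are simple and stay in
    \<open>S\<close>, so that appending a vertex from outside keeps them simple.\<close>
  define rooted where "rooted S \<longleftrightarrow> (\<exists>par (rank :: 'v \<Rightarrow> nat).
      (\<forall>v\<in>S - {r}. par v \<in> S \<and> rank (par v) < rank v) \<and>
      {e\<in>edges T. e \<subseteq> S} = (\<lambda>v. {v, par v}) ` (S - {r}))" for S
  define joined where "joined S \<longleftrightarrow> (\<forall>u\<in>S. \<forall>w\<in>S.
      \<exists>p. walk T p \<and> distinct p \<and> set p \<subseteq> S \<and> hd p = u \<and> last p = w)" for S
  define good where "good S \<longleftrightarrow> r \<in> S \<and> S \<subseteq> verts T \<and> rooted S \<and> joined S" for S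
  have "good {r}"
  proof -
    have "{e\<in>edges T. e \<subseteq> {r}} = {}"
      using edge by fastforce
    then have "rooted {r}"
      by (auto simp: rooted_def)
    moreover have "joined {r}"
      using r by (auto simp: joined_def walk_def intro!: exI[of _ "[r]"])
    ultimately show ?thesis
      using r by (simp add: good_def)
  qed
  have extend: "\<exists>S'. good S' \<and> card S < card S'" if S: "good S" "S \<noteq> verts T" for S
  proof -
    obtain z where z: "z \<in> verts T" "z \<notin> S"
      using S by (auto simp: good_def)
    obtain q where "walk T q" "hd q = r" "last q = z"
      using conn[OF r z(1)] by blast
    moreover have "r \<in> S"
      using S by (simp add: good_def)
    ultimately have "\<exists>s\<in>S. \<exists>v\<in>verts T - S. {s, v} \<in> edges T"
      using z by (intro walk_leaves_set[of T q]) auto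
    then obtain s v where sv: "s \<in> S" "v \<in> verts T" "v \<notin> S" "{s, v} \<in> edges T"
      by blast
    have J: "\<exists>p. walk T p \<and> distinct p \<and> set p \<subseteq> S \<and> hd p = a \<and> last p = b"
      if "a \<in> S" "b \<in> S" for a b
      using S that by (simp add: good_def joined_def)
    have uniq: "s' = s" if s': "s' \<in> S" "{s', v} \<in> edges T" for s'
    proof (rule ccontr)
      assume ne: "s' \<noteq> s"
      obtain p where p: "walk T p" "distinct p" "set p \<subseteq> S" "hd p = s" "last p = s'"
        using J[OF sv(1) s'(1)] by blast
      have "walk T (p @ [v])"
        using p s' sv by (intro walk_snoc) auto
      moreover have "distinct (p @ [v])"
        using p sv by auto
      moreover have "3 \<le> length (p @ [v])"
      proof (rule ccontr)
        assume "\<not> 3 \<le> length (p @ [v])"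
        then have "length p < 2" by simp
        then have "length p = 1"
          using p by (cases p) (auto simp: walk_def)
        then show False
          using p ne by (cases p) auto
      qed
      moreover have "hd (p @ [v]) = s"
        using p by (auto simp: walk_def)
      ultimately have "graph_cycle T (p @ [v])"
        using sv by (simp add: graph_cycle_def insert_commute)
      then show False
        using acyc by blast
    qed
    let ?S = "insert v S"
    obtain par and rank :: "'v \<Rightarrow> nat" where pr:
      "\<And>v. v \<in> S - {r} \<Longrightarrow> par v \<in> S \<and> rank (par v) < rank v"
      "{e\<in>edges T. e \<subseteq> S} = (\<lambda>v. {v, par v}) ` (S - {r})"
    proof -
      have "rooted S"
        using S by (simp add: good_def)
      then show thesis
        unfolding rooted_def by (elim exE conjE, intro that) auto
    qed
    have "v \<noteq> r"
      using S sv by (auto simp: good_def)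
    have "rooted ?S"
      unfolding rooted_def
    proof (intro exI conjI ballI)
      fix w assume "w \<in> ?S - {r}"
      then show "(par(v := s)) w \<in> ?S" "(rank(v := Suc (rank s))) ((par(v := s)) w) < (rank(v := Suc (rank s))) w"
        using pr(1)[of w] sv by auto
    next
      have *: "(\<lambda>w. {w, (par(v := s)) w}) ` (S - {r}) = (\<lambda>w. {w, par w}) ` (S - {r})"
        using sv by (intro image_cong) auto
      have "{e\<in>edges T. e \<subseteq> ?S} = insert {v, s} {e\<in>edges T. e \<subseteq> S}"
      proof (intro equalityI subsetI)
        fix e assume "e \<in> {e\<in>edges T. e \<subseteq> ?S}"
        then have e: "e \<in> edges T" "e \<subseteq> ?S" by auto
        show "e \<in> insert {v, s} {e\<in>edges T. e \<subseteq> S}"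
        proof (cases "v \<in> e")
          case True
          obtain a b where "a \<noteq> b" "e = {a, b}"
            using edge[OF e(1)] by blast
          with True obtain s' where s': "e = {s', v}" "s' \<noteq> v"
            by auto
          then have "s' = s"
            using e uniq by auto
          then show ?thesis
            using s' by auto
        qed (use e in auto)
      qed (use sv in \<open>auto simp: insert_commute\<close>)
      also have "\<dots> = (\<lambda>w. {w, (par(v := s)) w}) ` (?S - {r})"
        unfolding pr(2) using \<open>v \<noteq> r\<close> * by (simp add: insert_Diff_if)
      finally show "{e\<in>edges T. e \<subseteq> ?S} = (\<lambda>w. {w, (par(v := s)) w}) ` (?S - {r})" .
    qed
    moreover have "joined ?S"
      unfolding joined_def
    proof (intro ballI)
      fix u w assume uw: "u \<in> ?S" "w \<in> ?S"
      consider "u = v" "w = v" | "u = v" "w \<in> S" | "u \<in> S" "w = v" | "u \<in> S" "w \<in> S"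
        using uw by auto
      then show "\<exists>p. walk T p \<and> distinct p \<and> set p \<subseteq> ?S \<and> hd p = u \<and> last p = w"
      proof cases
        case 1
        then show ?thesis
          using sv by (intro exI[of _ "[v]"]) (auto simp: walk_def)
      next
        case 2
        then obtain p where p: "walk T p" "distinct p" "set p \<subseteq> S" "hd p = s" "last p = w"
          using J sv by blast
        then have "walk T (v # p)"
          using sv by (intro walk_Cons) (auto simp: insert_commute)
        then show ?thesis
          using p 2 sv by (intro exI[of _ "v # p"]) (auto simp: walk_def)
      next
        case 3
        then obtain p where p: "walk T p" "distinct p" "set p \<subseteq> S" "hd p = u" "last p = s"
          using J sv by blast
        then have "walk T (p @ [v])"
          using sv by (intro walk_snoc) auto
        then show ?thesis
          using p 3 sv by (intro exI[of _ "p @ [v]"]) (auto simp: walk_def)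
      next
        case 4
        then show ?thesis
          using J by blast
      qed
    qed
    moreover have "card S < card ?S"
      using sv S fin by (auto simp: good_def card_insert_if dest: finite_subset)
    ultimately show ?thesis
      using S sv by (auto simp: good_def intro!: exI[of _ ?S])
  qed
  \<comment> \<open>\<open>ex_has_greatest_nat\<close> is used with a strict bound, hence the
    \<open>Suc\<close>.\<close>
  have bound: "\<forall>S. good S \<longrightarrow> card S < Suc (card (verts T))"
    using fin by (auto simp: good_def less_Suc_eq_le intro!: card_mono)
  obtain S where S: "good S" and max: "\<And>S'. good S' \<Longrightarrow> card S' \<le> card S"
    using ex_has_greatest_nat[of good "{r}" card, OF \<open>good {r}\<close> bound] by blast
  have "S = verts T"
    using extend[OF S] max by (meson leD)
  moreover have "{e\<in>edges T. e \<subseteq> verts T} = edges T"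
    using edge by fastforce
  ultimately have "rooted (verts T)" "{e\<in>edges T. e \<subseteq> verts T} = edges T"
    using S by (auto simp: good_def)
  then obtain par and rank :: "'v \<Rightarrow> nat" where
    "\<forall>v\<in>verts T - {r}. par v \<in> verts T \<and> rank (par v) < rank v"
    "edges T = (\<lambda>v. {v, par v}) ` (verts T - {r})"
    unfolding rooted_def by (elim exE conjE) simp
  then show ?thesis
    by (intro that[of par rank]) blast+
qed

text \<open>The vertex sets of the trees are disjoint, so every vertex has a well-defined tree
  \<open>idx v\<close>, and the parent maps and ranks of the trees can be glued. Ranks are only ever
  compared along a parent link, hence within one tree.\<close>

lemma forest_rooting:
  assumes tree: "\<And>i. i \<in> I \<Longrightarrow> tree_graph (T i)" and GT: "disjoint_union_of G I T" and r: "\<And>i. i \<in> I \<Longrightarrow> r i \<in> verts (T i)"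
  obtains par and rank :: "'v \<Rightarrow> nat"
  where "\<And>v. v \<in> verts G - r ` I \<Longrightarrow> par v \<in> verts G \<and> rank (par v) < rank v"
    and "edges G = (\<lambda>v. {v, par v}) ` (verts G - r ` I)"
proof -
  have "\<exists>par (rank :: 'v \<Rightarrow> nat). (\<forall>v\<in>verts (T i) - {r i}. par v \<in> verts (T i) \<and> rank (par v) < rank v) \<and>
      edges (T i) = (\<lambda>v. {v, par v}) ` (verts (T i) - {r i})" if i: "i \<in> I" for i
  proof -
    obtain par and rank :: "'v \<Rightarrow> nat" where
      "\<And>v. v \<in> verts (T i) - {r i} \<Longrightarrow> par v \<in> verts (T i) \<and> rank (par v) < rank v"
      "edges (T i) = (\<lambda>v. {v, par v}) ` (verts (T i) - {r i})"
      by (rule tree_rooting[OF tree[OF i] r[OF i]]) (rule that)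
    then show ?thesis
      by blast
  qed
  then have "\<forall>i\<in>I. \<exists>par (rank :: 'v \<Rightarrow> nat). (\<forall>v\<in>verts (T i) - {r i}. par v \<in> verts (T i) \<and> rank (par v) < rank v) \<and>
      edges (T i) = (\<lambda>v. {v, par v}) ` (verts (T i) - {r i})" ..
  from bchoice[OF this] obtain par where "\<forall>i\<in>I. \<exists>rank :: 'v \<Rightarrow> nat.
      (\<forall>v\<in>verts (T i) - {r i}. par i v \<in> verts (T i) \<and> rank (par i v) < rank v) \<and>
      edges (T i) = (\<lambda>v. {v, par i v}) ` (verts (T i) - {r i})" ..
  from bchoice[OF this] obtain rank :: "_ \<Rightarrow> 'v \<Rightarrow> nat" where *: "\<forall>i\<in>I.
      (\<forall>v\<in>verts (T i) - {r i}. par i v \<in> verts (T i) \<and> rank i (par i v) < rank i v) \<and>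
      edges (T i) = (\<lambda>v. {v, par i v}) ` (verts (T i) - {r i})" ..
  have vG: "verts G = (\<Union>i\<in>I. verts (T i))" and eG: "edges G = (\<Union>i\<in>I. edges (T i))"
    and disj: "\<And>i j v. i \<in> I \<Longrightarrow> j \<in> I \<Longrightarrow> v \<in> verts (T i) \<Longrightarrow> v \<in> verts (T j) \<Longrightarrow> i = j"
    using GT by (auto simp: disjoint_union_of_def disjoint_family_on_def)
  define idx where "idx v = (THE i. i \<in> I \<and> v \<in> verts (T i))" for v
  have idx: "idx v = i" if "i \<in> I" "v \<in> verts (T i)" for i v
    unfolding idx_def using that disj by blast
  define P where "P v = par (idx v) v" for v
  define K where "K v = rank (idx v) v" for v
  have roots: "verts (T i) - {r i} = verts (T i) - r ` I" if "i \<in> I" for i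
    using that disj r by blast
  show ?thesis
  proof (rule that[of P K])
    fix v assume v: "v \<in> verts G - r ` I"
    then obtain i where i: "i \<in> I" "v \<in> verts (T i)"
      using vG by auto
    then have vi: "v \<in> verts (T i) - {r i}"
      using v by auto
    then have "par i v \<in> verts (T i)" "rank i (par i v) < rank i v"
      using * i by auto
    then show "P v \<in> verts G \<and> K (P v) < K v"
      using i idx vG by (auto simp: P_def K_def)
  next
    have "(\<lambda>v. {v, par i v}) ` (verts (T i) - {r i}) = (\<lambda>v. {v, P v}) ` (verts (T i) - r ` I)" if "i \<in> I" for i
      unfolding roots[OF that] using that idx by (intro image_cong) (auto simp: P_def)
    then have "edges G = (\<Union>i\<in>I. (\<lambda>v. {v, P v}) ` (verts (T i) - r ` I))"
      using * eG by auto
    also have "\<dots> = (\<lambda>v. {v, P v}) ` (verts G - r ` I)"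
      by (auto simp: vG)
    finally show "edges G = (\<lambda>v. {v, P v}) ` (verts G - r ` I)" .
  qed
qed

text \<open>Two distinct vertices with the same parent edge would be parents of each other, and
  \<open>rank\<close> would strictly decrease along a cycle of length two.\<close>

lemma sum_parent_edges:
  fixes rank :: "'v \<Rightarrow> nat" and h :: "'v set \<Rightarrow> real"
  assumes "\<And>v. v \<in> A \<Longrightarrow> rank (par v) < rank v"
  shows "(\<Sum>e\<in>(\<lambda>v. {v, par v}) ` A. h e) = (\<Sum>v\<in>A. h {v, par v})"
proof (rule sum.reindex_cong[OF _ refl refl])
  show "inj_on (\<lambda>v. {v, par v}) A"
  proof
    fix u v assume uv: "u \<in> A" "v \<in> A" "{u, par u} = {v, par v}"
    then show "u = v"
      using assms[of u] assms[of v] by (auto simp: doubleton_eq_iff)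
  qed
qed

section \<open>Projections of Borel sets up to null sets\<close>

text \<open>Inner regularity of one set with respect to a paving \<open>K\<close>. The paving stays
  abstract because it is instantiated twice: by compact sets, and by
  \<open>simple_compact_sections\<close>.\<close>

definition inner_approx :: "'a measure \<Rightarrow> 'a set set \<Rightarrow> 'a set \<Rightarrow> bool" where
  "inner_approx M K E \<longleftrightarrow> E \<in> sets M \<and>
     (\<forall>e>0. \<exists>C\<in>K. C \<subseteq> E \<and> measure M (E - C) < e)"

lemma (in finite_measure) measure_UN_tail_less:
  assumes A: "\<And>i::nat. A i \<in> sets M" and "0 < e"
  shows "\<exists>N. measure M ((\<Union>i. A i) - (\<Union>i<N. A i)) < e"
proof -
  have "(\<lambda>N. measure M (\<Union>i<N. A i)) \<longlonglongrightarrow> measure M (\<Union>N. \<Union>i<N. A i)"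
    using A by (intro finite_Lim_measure_incseq) (auto simp: incseq_def, fastforce)
  moreover have "(\<Union>N. \<Union>i<N. A i) = (\<Union>i. A i)"
    by auto
  ultimately have "(\<lambda>N. measure M (\<Union>i. A i) - measure M (\<Union>i<N. A i)) \<longlonglongrightarrow> 0"
    by (auto intro!: tendsto_eq_intros)
  then have "\<forall>\<^sub>F N in sequentially. measure M (\<Union>i. A i) - measure M (\<Union>i<N. A i) < e"
    using \<open>0 < e\<close> by (rule order_tendstoD)
  then obtain N where "measure M (\<Union>i. A i) - measure M (\<Union>i<N. A i) < e"
    by (auto simp: eventually_sequentially)
  moreover have "measure M ((\<Union>i. A i) - (\<Union>i<N. A i)) = measure M (\<Union>i. A i) - measure M (\<Union>i<N. A i)"
    using A by (intro finite_measure_Diff) auto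
  ultimately show ?thesis
    by (intro exI[of _ N]) linarith
qed

text \<open>The weights add up to \<open>e / 2\<close> rather than \<open>e\<close>, which leaves
  room for the strict inequality after summing the series.\<close>

lemma (in finite_measure) measure_UN_less_geometric:
  assumes B: "\<And>i::nat. B i \<in> sets M" and "0 < e"
    and le: "\<And>i. measure M (B i) < e / 2 * (1/2) ^ Suc i"
  shows "measure M (\<Union>i. B i) < e"
proof -
  have s: "(\<lambda>i. e / 2 * (1/2) ^ Suc i) sums (e / 2 * 1)"
    by (intro sums_mult power_half_series)
  have sm: "summable (\<lambda>i. measure M (B i))"
    using le by (intro summable_comparison_test'[OF sums_summable[OF s], of 0]) (auto intro: less_imp_le)
  have "measure M (\<Union>i. B i) \<le> (\<Sum>i. measure M (B i))"
    using B sm by (intro finite_measure_subadditive_countably) auto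
  also have "\<dots> \<le> e / 2"
    using suminf_le[OF less_imp_le[OF le] sm sums_summable[OF s]] sums_unique[OF s] by simp
  finally show ?thesis
    using \<open>0 < e\<close> by linarith
qed

text \<open>\<open>K\<close> is closed under finite unions only, so half of \<open>e\<close> pays
  for cutting the union off at \<open>N\<close> and the other half is spread geometrically over the
  approximations of the pieces.\<close>

lemma (in finite_measure) inner_approx_UN:
  assumes K: "K \<subseteq> sets M" "{} \<in> K" "\<And>C D. C \<in> K \<Longrightarrow> D \<in> K \<Longrightarrow> C \<union> D \<in> K"
    and A: "\<And>i::nat. inner_approx M K (A i)"
  shows "inner_approx M K (\<Union>i. A i)"
  unfolding inner_approx_def
proof (intro conjI allI impI)
  have [measurable]: "\<And>i. A i \<in> sets M"
    using A by (auto simp: inner_approx_def)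
  show "(\<Union>i. A i) \<in> sets M"
    by measurable
  fix e :: real assume "0 < e"
  then obtain N where N: "measure M ((\<Union>i. A i) - (\<Union>i<N. A i)) < e / 2"
    using measure_UN_tail_less[of A "e/2"] by auto
  have "\<forall>i. \<exists>C\<in>K. C \<subseteq> A i \<and> measure M (A i - C) < e / 2 / 2 * (1/2) ^ Suc i"
  proof
    fix i
    have "0 < e / 2 / 2 * (1/2) ^ Suc i"
      using \<open>0 < e\<close> by simp
    then show "\<exists>C\<in>K. C \<subseteq> A i \<and> measure M (A i - C) < e / 2 / 2 * (1/2) ^ Suc i"
      using A unfolding inner_approx_def by blast
  qed
  then obtain C where C: "\<And>i. C i \<in> K" "\<And>i. C i \<subseteq> A i"
      "\<And>i. measure M (A i - C i) < e / 2 / 2 * (1/2) ^ Suc i"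
    by metis
  have [measurable]: "\<And>i. C i \<in> sets M"
    using C K by auto
  have "(\<Union>i<n. C i) \<in> K" for n
    by (induction n) (auto simp: lessThan_Suc K C)
  moreover have "measure M ((\<Union>i. A i) - (\<Union>i<N. C i)) < e"
  proof -
    have "measure M ((\<Union>i. A i) - (\<Union>i<N. C i)) \<le>
        measure M (((\<Union>i. A i) - (\<Union>i<N. A i)) \<union> (\<Union>i. A i - C i))"
      by (intro finite_measure_mono) (auto, measurable)
    also have "\<dots> \<le> measure M ((\<Union>i. A i) - (\<Union>i<N. A i)) + measure M (\<Union>i. A i - C i)"
      by (intro measure_Un_le) auto
    also have "measure M (\<Union>i. A i - C i) < e / 2"
      using \<open>0 < e\<close> C by (intro measure_UN_less_geometric) auto
    finally show ?thesis
      using N by linarith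
  qed
  moreover have "(\<Union>i<N. C i) \<subseteq> (\<Union>i. A i)"
    using C(2) by blast
  ultimately show "\<exists>C\<in>K. C \<subseteq> (\<Union>i. A i) \<and> measure M ((\<Union>i. A i) - C) < e"
    by blast
qed

text \<open>No truncation is required here, since \<open>K\<close> is closed under countable
  intersections: a point of the intersection lost by the \<open>C i\<close> lies in some
  \<open>A i - C i\<close>.\<close>

lemma (in finite_measure) inner_approx_INT:
  assumes K: "K \<subseteq> sets M" "\<And>C. range C \<subseteq> K \<Longrightarrow> (\<Inter>i::nat. C i) \<in> K"
    and A: "\<And>i::nat. inner_approx M K (A i)"
  shows "inner_approx M K (\<Inter>i. A i)"
  unfolding inner_approx_def
proof (intro conjI allI impI)
  have [measurable]: "\<And>i. A i \<in> sets M"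
    using A by (auto simp: inner_approx_def)
  show "(\<Inter>i. A i) \<in> sets M"
    by measurable
  fix e :: real assume "0 < e"
  have "\<forall>i. \<exists>C\<in>K. C \<subseteq> A i \<and> measure M (A i - C) < e / 2 * (1/2) ^ Suc i"
  proof
    fix i
    have "0 < e / 2 * (1/2) ^ Suc i"
      using \<open>0 < e\<close> by simp
    then show "\<exists>C\<in>K. C \<subseteq> A i \<and> measure M (A i - C) < e / 2 * (1/2) ^ Suc i"
      using A unfolding inner_approx_def by blast
  qed
  then obtain C where C: "\<And>i. C i \<in> K" "\<And>i. C i \<subseteq> A i"
      "\<And>i. measure M (A i - C i) < e / 2 * (1/2) ^ Suc i"
    by metis
  have [measurable]: "\<And>i. C i \<in> sets M"
    using C K by auto
  have "measure M ((\<Inter>i. A i) - (\<Inter>i. C i)) \<le> measure M (\<Union>i. A i - C i)"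
    by (intro finite_measure_mono) auto
  also have "\<dots> < e"
    using \<open>0 < e\<close> C by (intro measure_UN_less_geometric) auto
  finally have "measure M ((\<Inter>i. A i) - (\<Inter>i. C i)) < e" .
  moreover have "(\<Inter>i. C i) \<subseteq> (\<Inter>i. A i)"
    using C(2) by blast
  moreover have "(\<Inter>i. C i) \<in> K"
    using C(1) by (intro K(2)) auto
  ultimately show "\<exists>C\<in>K. C \<subseteq> (\<Inter>i. A i) \<and> measure M ((\<Inter>i. A i) - C) < e"
    by blast
qed

text \<open>Approximability alone is not visibly stable under complements. The induction therefore
  carries a set together with its complement; a countable union then uses
  \<open>inner_approx_UN\<close> for the set and \<open>inner_approx_INT\<close> for the
  complement.\<close>

lemma (in finite_measure) inner_approx_sigma_sets:
  assumes K: "K \<subseteq> sets M" "{} \<in> K" "\<And>C D. C \<in> K \<Longrightarrow> D \<in> K \<Longrightarrow> C \<union> D \<in> K"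
      "\<And>C. range C \<subseteq> K \<Longrightarrow> (\<Inter>i::nat. C i) \<in> K"
    and space: "inner_approx M K (space M)"
    and gen: "\<And>A. A \<in> G \<Longrightarrow> inner_approx M K A" "\<And>A. A \<in> G \<Longrightarrow> inner_approx M K (space M - A)"
    and E: "E \<in> sigma_sets (space M) G"
  shows "inner_approx M K E"
proof -
  have "inner_approx M K E \<and> inner_approx M K (space M - E)"
    using E
  proof induction
    case (Basic A)
    then show ?case
      using gen by auto
  next
    case Empty
    then show ?case
      using K space by (auto simp: inner_approx_def)
  next
    case (Compl A)
    then have "A \<subseteq> space M"
      by (auto simp: inner_approx_def dest: sets.sets_into_space)
    then show ?case
      using Compl by (simp add: double_diff)
  next
    case (Union A)
    have "space M - (\<Union>i. A i) = (\<Inter>i. space M - A i)"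
      by auto
    then show ?case
      using Union inner_approx_UN[of K A] inner_approx_INT[of K "\<lambda>i. space M - A i"] K by simp
  qed
  then show ?thesis ..
qed

section \<open>Tightness and inner regularity on Polish spaces\<close>

lemma space_borel_of_topology [simp]: "space (borel_of_topology X) = topspace X"
  by (simp add: borel_of_topology_def space_measure_of_conv)

lemma sets_borel_of_topology:
  "sets (borel_of_topology X) = sigma_sets (topspace X) {U. openin X U}"
  unfolding borel_of_topology_def by (intro sets_measure_of) (auto dest: openin_subset)

lemma openin_in_borel: "openin X U \<Longrightarrow> U \<in> sets (borel_of_topology X)"
  by (auto simp: sets_borel_of_topology)

lemma closedin_in_borel: "closedin X C \<Longrightarrow> C \<in> sets (borel_of_topology X)"
proof -
  assume C: "closedin X C"
  then have "C = space (borel_of_topology X) - (topspace X - C)"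
    by (auto dest: closedin_subset)
  then show ?thesis
    using C by (metis closedin_def openin_in_borel sets.compl_sets)
qed

text \<open>Ulam's theorem. For each \<open>n\<close>, finitely many closed balls of radius
  \<open>1 / Suc n\<close> around a dense sequence cover all but a geometrically small mass. The
  intersection over \<open>n\<close> of these finite unions is closed and totally bounded, hence
  compact by completeness.\<close>

lemma polish_tight:
  assumes X: "polish_topology X" and M: "finite_measure M" "sets M = sets (borel_of_topology X)"
    and "0 < e"
  shows "\<exists>C. compactin X C \<and> measure M (topspace X - C) < e"
proof (cases "topspace X = {}")
  case True
  then show ?thesis
    using \<open>0 < e\<close> by (intro exI[of _ "{}"]) auto
next
  case False
  interpret finite_measure M by fact
  obtain m d where md: "Metric_space m d" "Metric_space.mcomplete m d" "X = Metric_space.mtopology m d"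
    using X by (auto simp: polish_topology_def completely_metrizable_space_def)
  interpret Metric_space m d by fact
  have Xm: "topspace X = m"
    using md by simp
  obtain D where D: "countable D" "D \<subseteq> m" "X closure_of D = m"
    using X Xm by (auto simp: polish_topology_def separable_space_def)
  have "D \<noteq> {}"
    using D False Xm by auto
  define x where "x = from_nat_into D"
  have x: "range x = D" "\<And>i. x i \<in> m"
    using D \<open>D \<noteq> {}\<close> range_from_nat_into[of D] from_nat_into[of D] by (auto simp: x_def)
  have cover: "(\<Union>i. mcball (x i) (1 / Suc n)) = m" for n
  proof safe
    fix y assume "y \<in> m"
    then have "y \<in> mtopology closure_of D"
      using D md by auto
    then have "\<forall>r>0. \<exists>z\<in>D. z \<in> mball y r"
      unfolding metric_closure_of by blast
    moreover have "0 < 1 / real (Suc n)"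
      by simp
    ultimately obtain z where "z \<in> D" "z \<in> mball y (1 / Suc n)"
      by blast
    then obtain i where "z = x i"
      using x by auto
    then show "y \<in> (\<Union>i. mcball (x i) (1 / Suc n))"
      using \<open>z \<in> mball y (1 / Suc n)\<close> \<open>y \<in> m\<close> x by (intro UN_I[of i]) (auto simp: commute)
  qed auto
  have closed: "closedin X (mcball y r)" for y r
    using closedin_mcball md by simp
  then have meas [measurable]: "mcball y r \<in> sets M" for y r
    using M closedin_in_borel by blast
  have "\<exists>N. measure M (m - (\<Union>i<N. mcball (x i) (1 / Suc n))) < e / 2 * (1/2) ^ Suc n" for n
    using measure_UN_tail_less[of "\<lambda>i. mcball (x i) (1 / Suc n)" "e / 2 * (1/2) ^ Suc n", OF meas] \<open>0 < e\<close>
    unfolding cover by simp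
  then obtain N where N: "\<And>n. measure M (m - (\<Union>i<N n. mcball (x i) (1 / Suc n))) < e / 2 * (1/2) ^ Suc n"
    by metis
  define C where "C = (\<Inter>n. \<Union>i<N n. mcball (x i) (1 / Suc n))"
  have "C \<subseteq> m"
    by (auto simp: C_def)
  have "closedin X C"
    unfolding C_def using closed by (intro closedin_INT closedin_Union) auto
  moreover have "mtotally_bounded C"
    unfolding mtotally_bounded_def
  proof (intro allI impI)
    fix r :: real assume "0 < r"
    then obtain n where n: "1 / Suc n < r / 2"
      using reals_Archimedean[of "r / 2"] by (auto simp: inverse_eq_divide)
    \<comment> \<open>Total boundedness asks for centres inside \<open>C\<close>, whereas the
      \<open>x i\<close> may lie outside. Each ball that meets \<open>C\<close> is recentred at a
      point of \<open>C\<close>; this doubles the radius, which is why \<open>n\<close> was chosen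
      with \<open>1 / Suc n < r / 2\<close>.\<close>
    define I where "I = {i. i < N n \<and> C \<inter> mcball (x i) (1 / Suc n) \<noteq> {}}"
    have "\<forall>i\<in>I. \<exists>y. y \<in> C \<inter> mcball (x i) (1 / Suc n)"
      by (auto simp: I_def)
    then obtain y where y: "\<And>i. i \<in> I \<Longrightarrow> y i \<in> C \<inter> mcball (x i) (1 / Suc n)"
      by metis
    have "z \<in> (\<Union>w\<in>y ` I. mball w r)" if z: "z \<in> C" for z
    proof -
      obtain i where i: "i < N n" "z \<in> mcball (x i) (1 / Suc n)"
        using z unfolding C_def by blast
      then have "i \<in> I"
        using z by (auto simp: I_def simp del: in_mcball)
      then have "d (y i) z < r"
        using y[of i] i n triangle[of "y i" "x i" z] by (auto simp: commute)
      then show ?thesis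
        using \<open>i \<in> I\<close> y[of i] i by auto
    qed
    moreover have "finite I"
      by (auto simp: I_def)
    ultimately show "\<exists>K. finite K \<and> K \<subseteq> C \<and> C \<subseteq> (\<Union>x\<in>K. mball x r)"
      using y by (intro exI[of _ "y ` I"]) auto
  qed
  ultimately have "compactin X C"
    using mtotally_bounded_eq_compact_closure_of md by (simp add: closure_of_closedin)
  moreover have "measure M (m - C) < e"
  proof -
    have "m - C = (\<Union>n. m - (\<Union>i<N n. mcball (x i) (1 / Suc n)))"
      by (auto simp: C_def)
    moreover have "m \<in> sets M"
      using cover[of 0] meas by (metis sets.countable_UN image_subset_iff)
    ultimately show ?thesis
      using N \<open>0 < e\<close> by (simp only:) (intro measure_UN_less_geometric, auto)
  qed
  ultimately show ?thesis
    using Xm by auto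
qed

lemma compactin_in_borel:
  assumes "polish_topology X" "compactin X C"
  shows "C \<in> sets (borel_of_topology X)"
  using assms
  by (auto simp: polish_topology_def intro!: closedin_in_borel compactin_imp_closedin metrizable_imp_Hausdorff_space
      completely_metrizable_imp_metrizable_space)

text \<open>Closed sets are handled by intersecting with a compact set from
  \<open>polish_tight\<close>. Open sets in a metrizable space are countable unions of closed ones,
  so both open sets and their complements are approximable, and the extension to Borel sets
  applies.\<close>

lemma polish_inner_regular:
  assumes X: "polish_topology X" and M: "finite_measure M" "sets M = sets (borel_of_topology X)"
    and E: "E \<in> sets M"
  shows "inner_approx M {C. compactin X C} E"
proof -
  interpret finite_measure M by fact
  have metr: "metrizable_space X"
    using X by (simp add: polish_topology_def completely_metrizable_imp_metrizable_space)
  have sp: "space M = topspace X"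
    using sets_eq_imp_space_eq[OF M(2)] by simp
  let ?K = "{C. compactin X C}"
  have K: "?K \<subseteq> sets M"
    using compactin_in_borel[OF X] M by auto
  have Un: "C \<union> D \<in> ?K" if "C \<in> ?K" "D \<in> ?K" for C D
    using that by (auto intro: compactin_Un)
  have INT: "(\<Inter>i::nat. C i) \<in> ?K" if "range C \<subseteq> ?K" for C
  proof -
    have "compactin X (C i)" for i
      using that by auto
    then have "closedin X (C i)" for i
      using metr by (simp add: compactin_imp_closedin metrizable_imp_Hausdorff_space)
    then have "closedin X (\<Inter>i. C i)"
      by auto
    then show ?thesis
      using closed_compactin[of X "C 0" "\<Inter>i. C i"] \<open>\<And>i. compactin X (C i)\<close> by auto
  qed
  have closed: "inner_approx M ?K C" if "closedin X C" for C
    unfolding inner_approx_def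
  proof (intro conjI allI impI)
    show "C \<in> sets M"
      using that M closedin_in_borel by auto
    fix e :: real assume "0 < e"
    then obtain D where D: "compactin X D" "measure M (topspace X - D) < e"
      using polish_tight[OF X M] by blast
    then have "D \<in> sets M"
      using K by auto
    have "measure M (C - C \<inter> D) \<le> measure M (topspace X - D)"
      using \<open>D \<in> sets M\<close> sets.top[of M] closedin_subset[OF that]
      by (intro finite_measure_mono) (auto simp: sp)
    then show "\<exists>D\<in>?K. D \<subseteq> C \<and> measure M (C - D) < e"
      using D closed_Int_compactin[OF that D(1)] by (intro bexI[of _ "C \<inter> D"]) auto
  qed
  show ?thesis
  proof (rule inner_approx_sigma_sets[OF K _ Un INT])
    show "E \<in> sigma_sets (space M) {U. openin X U}"
      using E M sp by (simp add: sets_borel_of_topology)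
    show "inner_approx M ?K (space M)"
      using closed[of "topspace X"] sp by simp
    fix U assume "U \<in> {U. openin X U}"
    then have U: "openin X U" by simp
    then show "inner_approx M ?K (space M - U)"
      using closed[OF closedin_diff[OF closedin_topspace U]] sp by simp
    obtain C where C: "\<And>n::nat. closedin X (C n)" "\<Union> (range C) = U"
      using open_imp_fsigma_in[OF metr U] unfolding fsigma_in_ascending by blast
    then show "inner_approx M ?K U"
      using inner_approx_UN[OF K _ Un, of C] closed by auto
  qed auto
qed

text \<open>Intersections of countably many finite unions of rectangles \<open>A \<times> C\<close> with \<open>C\<close> compact, written
  as multifunctions \<open>y \<mapsto> \<Inter>m. s m y\<close>: this class is closed under finite unions and countable
  intersections, and its members have measurable projections by compactness.\<close>

definition simple_compact_sections :: "'a measure \<Rightarrow> 'b topology \<Rightarrow> ('a \<times> 'b) set set" where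
  "simple_compact_sections N X = {Sigma (space N) (\<lambda>y. \<Inter>m. s m y) | s.
     \<forall>m::nat. simple_function N (s m) \<and> (\<forall>y\<in>space N. compactin X (s m y))}"

lemma simple_compact_sectionsI:
  assumes "\<And>m::nat. simple_function N (s m)" "\<And>m y. y \<in> space N \<Longrightarrow> compactin X (s m y)"
    and "K = Sigma (space N) (\<lambda>y. \<Inter>m. s m y)"
  shows "K \<in> simple_compact_sections N X"
  using assms unfolding simple_compact_sections_def by blast

lemma simple_compact_sectionsE:
  assumes "K \<in> simple_compact_sections N X"
  obtains s where "\<And>m::nat. simple_function N (s m)" "\<And>m y. y \<in> space N \<Longrightarrow> compactin X (s m y)"
    "K = Sigma (space N) (\<lambda>y. \<Inter>m. s m y)"
proof -
  obtain s where "K = Sigma (space N) (\<lambda>y. \<Inter>m. s m y)"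
    "\<forall>m::nat. simple_function N (s m) \<and> (\<forall>y\<in>space N. compactin X (s m y))"
    using assms unfolding simple_compact_sections_def mem_Collect_eq by (elim exE conjE) (rule that)
  then show ?thesis
    by (intro that[of s]) simp_all
qed

lemma Sigma_simple_function_measurable:
  assumes s: "simple_function N s" and c: "\<And>y. y \<in> space N \<Longrightarrow> s y \<in> sets L"
  shows "Sigma (space N) s \<in> sets (N \<Otimes>\<^sub>M L)"
proof -
  have "Sigma (space N) s = (\<Union>C\<in>s ` space N. (s -` {C} \<inter> space N) \<times> C)"
    by auto
  also have "\<dots> \<in> sets (N \<Otimes>\<^sub>M L)"
    using s c by (intro sets.finite_UN pair_measureI) (auto simp: simple_function_def)
  finally show ?thesis .
qed

lemma simple_compact_sections_sets:
  assumes X: "polish_topology X"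
  shows "simple_compact_sections N X \<subseteq> sets (N \<Otimes>\<^sub>M borel_of_topology X)"
proof
  fix K assume "K \<in> simple_compact_sections N X"
  then obtain s where s: "\<And>m::nat. simple_function N (s m)"
      "\<And>m y. y \<in> space N \<Longrightarrow> compactin X (s m y)" "K = Sigma (space N) (\<lambda>y. \<Inter>m. s m y)"
    by (rule simple_compact_sectionsE) (rule that)
  have "K = (\<Inter>m. Sigma (space N) (s m))"
    using s by auto
  moreover have "Sigma (space N) (s m) \<in> sets (N \<Otimes>\<^sub>M borel_of_topology X)" for m
    using s compactin_in_borel[OF X] by (intro Sigma_simple_function_measurable) auto
  ultimately show "K \<in> sets (N \<Otimes>\<^sub>M borel_of_topology X)"
    by auto
qed

text \<open>By distributivity, a union of two intersections is the intersection of all pairwise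
  unions; \<open>prod_decode\<close> enumerates the pairs.\<close>

lemma simple_compact_sections_Un:
  assumes "C \<in> simple_compact_sections N X" "D \<in> simple_compact_sections N X"
  shows "C \<union> D \<in> simple_compact_sections N X"
proof -
  obtain s where s: "\<And>m::nat. simple_function N (s m)"
      "\<And>m y. y \<in> space N \<Longrightarrow> compactin X (s m y)" "C = Sigma (space N) (\<lambda>y. \<Inter>m. s m y)"
    using assms(1) by (rule simple_compact_sectionsE) (rule that)
  obtain r where r: "\<And>m::nat. simple_function N (r m)"
      "\<And>m y. y \<in> space N \<Longrightarrow> compactin X (r m y)" "D = Sigma (space N) (\<lambda>y. \<Inter>m. r m y)"
    using assms(2) by (rule simple_compact_sectionsE) (rule that)
  show ?thesis
  proof (rule simple_compact_sectionsI)
    let ?t = "\<lambda>m y. s (fst (prod_decode m)) y \<union> r (snd (prod_decode m)) y"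
    show "simple_function N (?t m)" for m
      using s r by (intro simple_function_compose2[where h = "(\<union>)"]) auto
    show "compactin X (?t m y)" if "y \<in> space N" for m y
      using s r that by (intro compactin_Un) auto
    have "(\<Inter>m. ?t m y) = (\<Inter>m. s m y) \<union> (\<Inter>m. r m y)" for y
    proof (intro equalityI subsetI)
      fix z assume "z \<in> (\<Inter>m. ?t m y)"
      then have "z \<in> ?t (prod_encode (i, j)) y" for i j
        by blast
      then have "z \<in> s i y \<or> z \<in> r j y" for i j
        by simp
      then show "z \<in> (\<Inter>m. s m y) \<union> (\<Inter>m. r m y)"
        by (cases "\<forall>i. z \<in> s i y") auto
    next
      fix z assume "z \<in> (\<Inter>m. s m y) \<union> (\<Inter>m. r m y)"
      then show "z \<in> (\<Inter>m. ?t m y)"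
        by auto
    qed
    then show "C \<union> D = Sigma (space N) (\<lambda>y. \<Inter>m. ?t m y)"
      unfolding s(3) r(3) by auto
  qed
qed

lemma simple_compact_sections_INT:
  assumes "range C \<subseteq> simple_compact_sections N X"
  shows "(\<Inter>i::nat. C i) \<in> simple_compact_sections N X"
proof -
  have "\<exists>s. (\<forall>m::nat. simple_function N (s m)) \<and> (\<forall>m. \<forall>y\<in>space N. compactin X (s m y)) \<and>
      C i = Sigma (space N) (\<lambda>y. \<Inter>m. s m y)" for i
  proof -
    have "C i \<in> simple_compact_sections N X"
      using assms by (simp add: image_subset_iff)
    then obtain s where "\<And>m::nat. simple_function N (s m)"
      "\<And>m y. y \<in> space N \<Longrightarrow> compactin X (s m y)" "C i = Sigma (space N) (\<lambda>y. \<Inter>m. s m y)"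
      by (rule simple_compact_sectionsE) (rule that)
    then show ?thesis
      by (intro exI[of _ s]) simp
  qed
  then have "\<forall>i. \<exists>s. (\<forall>m::nat. simple_function N (s m)) \<and> (\<forall>m. \<forall>y\<in>space N. compactin X (s m y)) \<and>
      C i = Sigma (space N) (\<lambda>y. \<Inter>m. s m y)" ..
  from choice[OF this] obtain s where "\<forall>i. (\<forall>m::nat. simple_function N (s i m)) \<and> (\<forall>m. \<forall>y\<in>space N. compactin X (s i m y)) \<and>
      C i = Sigma (space N) (\<lambda>y. \<Inter>m. s i m y)"
    by (rule exE)
  then have s: "\<And>i m::nat. simple_function N (s i m)"
      "\<And>i m y. y \<in> space N \<Longrightarrow> compactin X (s i m y)" "\<And>i. C i = Sigma (space N) (\<lambda>y. \<Inter>m. s i m y)"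
    by auto
  show ?thesis
  proof (rule simple_compact_sectionsI)
    let ?t = "\<lambda>m. s (fst (prod_decode m)) (snd (prod_decode m))"
    show "simple_function N (?t m)" for m
      by (rule s)
    show "compactin X (?t m y)" if "y \<in> space N" for m y
      using s that by auto
    have "(\<Inter>m. ?t m y) = (\<Inter>i. \<Inter>j. s i j y)" for y
    proof (intro equalityI subsetI)
      fix z assume "z \<in> (\<Inter>m. ?t m y)"
      then have "z \<in> ?t (prod_encode (i, j)) y" for i j
        by blast
      then show "z \<in> (\<Inter>i. \<Inter>j. s i j y)"
        by simp
    qed auto
    then show "(\<Inter>i. C i) = Sigma (space N) (\<lambda>y. \<Inter>m. ?t m y)"
      unfolding s(3) by auto
  qed
qed

text \<open>By compactness, the section over \<open>y\<close> is nonempty as soon as every finite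
  intersection \<open>w m y\<close> is. Each \<open>w m\<close> is a simple function, so
  nonemptiness of \<open>w m y\<close> is a measurable condition on \<open>y\<close>, and only
  countably many such conditions occur.\<close>

lemma fst_simple_compact_sections:
  assumes X: "polish_topology X" and K: "K \<in> simple_compact_sections N X"
  shows "fst ` K \<in> sets N"
proof -
  have H: "Hausdorff_space X"
    using X by (simp add: polish_topology_def completely_metrizable_imp_metrizable_space metrizable_imp_Hausdorff_space)
  obtain s where s: "\<And>m::nat. simple_function N (s m)"
      "\<And>m y. y \<in> space N \<Longrightarrow> compactin X (s m y)" "K = Sigma (space N) (\<lambda>y. \<Inter>m. s m y)"
    using K by (rule simple_compact_sectionsE) (rule that)
  define w where "w m y = (\<Inter>l\<le>m. s l y)" for m y
  have w: "simple_function N (w m)" for m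
  proof (induction m)
    case 0
    then show ?case
      using s by (simp add: w_def)
  next
    case (Suc m)
    have "w (Suc m) = (\<lambda>y. w m y \<inter> s (Suc m) y)"
      by (auto simp: w_def atMost_Suc)
    then show ?case
      using Suc s by (simp add: simple_function_compose2[where h = "(\<inter>)"])
  qed
  have "fst ` K = (\<Inter>m. w m -` (- {{}}) \<inter> space N)"
  proof safe
    fix y assume y: "y \<in> (\<Inter>m. w m -` (- {{}}) \<inter> space N)"
    then have yN: "y \<in> space N" and ne: "\<And>m. w m y \<noteq> {}"
      by auto
    have cl: "closedin X (s m y)" for m
      using s yN H by (intro compactin_imp_closedin) auto
    let ?S = "subtopology X (s 0 y)"
    have "(\<Inter>m. w m y) \<noteq> {}"
    proof (rule compact_space_imp_nest[of ?S])
      show "compact_space ?S"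
        using s yN by (auto simp: compactin_subspace)
      have "closedin X (w m y)" for m
        using cl unfolding w_def by (intro closedin_INT) auto
      moreover have "w m y \<subseteq> s 0 y" for m
        by (auto simp: w_def)
      ultimately show "closedin ?S (w m y)" for m
        by (simp add: closedin_subset_topspace)
      show "decseq (\<lambda>m. w m y)"
        by (auto simp: decseq_def w_def)
    qed (use ne in auto)
    then obtain z where "z \<in> (\<Inter>m. w m y)"
      by auto
    then have "(y, z) \<in> K"
      using yN s by (auto simp: w_def)
    then show "y \<in> fst ` K"
      by force
  qed (auto simp: s w_def)
  also have "\<dots> \<in> sets N"
  proof (rule sets.countable_INT)
    show "range (\<lambda>m. w m -` (- {{}}) \<inter> space N) \<subseteq> sets N"
      using simple_functionD(2)[OF w] by blast
  qed simp
  finally show ?thesis .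
qed

text \<open>In a rectangle only the topological side has to be shrunk, using inner regularity of the
  second marginal; the side in \<open>N\<close> is kept exactly, so \<open>N\<close> can be an
  arbitrary measurable space. The complement of a rectangle is a union of two rectangles.\<close>

lemma inner_approx_simple_compact_sections:
  assumes fin: "finite_measure M" and X: "polish_topology X" and M: "sets M = sets (N \<Otimes>\<^sub>M borel_of_topology X)"
    and E: "E \<in> sets M"
  shows "inner_approx M (simple_compact_sections N X) E"
proof -
  interpret finite_measure M by fact
  let ?K = "simple_compact_sections N X" and ?L = "borel_of_topology X"
  have sp: "space M = space N \<times> topspace X"
    using sets_eq_imp_space_eq[OF M] by (simp add: space_pair_measure)
  have K: "?K \<subseteq> sets M"
    using simple_compact_sections_sets[OF X] M by auto
  have empty: "{} \<in> ?K"
    by (rule simple_compact_sectionsI[of _ "\<lambda>_ _. {}"]) auto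
  have rect: "inner_approx M ?K (A \<times> B)" if A: "A \<in> sets N" and B: "B \<in> sets ?L" for A B
    unfolding inner_approx_def
  proof (intro conjI allI impI)
    show AB: "A \<times> B \<in> sets M"
      using A B M by auto
    fix e :: real assume "0 < e"
    have snd: "snd \<in> measurable M ?L"
      by (subst measurable_cong_sets[OF M refl]) (rule measurable_snd)
    interpret D: finite_measure "distr M ?L snd"
      using snd by (rule finite_measure_distr)
    have "inner_approx (distr M ?L snd) {C. compactin X C} B"
      using B by (intro polish_inner_regular[OF X D.finite_measure_axioms]) auto
    then obtain C where C: "compactin X C" "C \<subseteq> B" "measure (distr M ?L snd) (B - C) < e"
      using \<open>0 < e\<close> by (auto simp: inner_approx_def)
    have CL: "C \<in> sets ?L"
      using compactin_in_borel[OF X C(1)] .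
    have "measure M (A \<times> B - A \<times> C) \<le> measure M (snd -` (B - C) \<inter> space M)"
      using B CL sets.sets_into_space[OF A] sets.sets_into_space[OF B]
      by (intro finite_measure_mono measurable_sets[OF snd]) (auto simp: sp)
    also have "\<dots> = measure (distr M ?L snd) (B - C)"
      using B CL by (intro measure_distr[symmetric] snd) auto
    also have "\<dots> < e"
      by fact
    finally have less: "measure M (A \<times> B - A \<times> C) < e" .
    have "A \<times> C \<in> ?K"
    proof (rule simple_compact_sectionsI)
      have "{x \<in> space N. x \<in> A} = A"
        using sets.sets_into_space[OF A] by auto
      then show "simple_function N (\<lambda>y. if y \<in> A then C else {})"
        using A by (intro simple_function_If) auto
      show "compactin X (if y \<in> A then C else {})" for y
        using C by auto
      show "A \<times> C = (SIGMA y:space N. \<Inter>m. if y \<in> A then C else {})"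
        using sets.sets_into_space[OF A] by (auto split: if_splits)
    qed
    then show "\<exists>D\<in>?K. D \<subseteq> A \<times> B \<and> measure M (A \<times> B - D) < e"
      using less C(2) by (intro bexI[of _ "A \<times> C"]) auto
  qed
  let ?G = "{A \<times> B | A B. A \<in> sets N \<and> B \<in> sets ?L}"
  show ?thesis
  proof (rule inner_approx_sigma_sets[OF K empty simple_compact_sections_Un simple_compact_sections_INT])
    show "E \<in> sigma_sets (space M) ?G"
      using E unfolding M sets_pair_measure sp by simp
    show "inner_approx M ?K (space M)"
      unfolding sp using rect[of "space N" "topspace X"] sets.top[of ?L] by simp
    fix R assume "R \<in> ?G"
    then obtain A B where R: "R = A \<times> B" "A \<in> sets N" "B \<in> sets ?L"
      by auto
    then show "inner_approx M ?K R"
      using rect by auto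
    let ?P = "(space N - A) \<times> topspace X" and ?Q = "A \<times> (topspace X - B)"
    have eq: "space M - R = ?P \<union> ?Q"
      using sets.sets_into_space[OF R(2)] sets.sets_into_space[OF R(3)] by (auto simp: sp R)
    have P: "inner_approx M ?K ?P"
      using rect[of "space N - A" "topspace X"] R(2) sets.top[of ?L] by simp
    have Q: "inner_approx M ?K ?Q"
      using rect[of A "topspace X - B"] R sets.compl_sets[of B ?L] by simp
    have "inner_approx M ?K (binary ?P ?Q i)" for i
      using P Q by (simp add: binary_def)
    then show "inner_approx M ?K (space M - R)"
      unfolding eq Un_range_binary by (intro inner_approx_UN[OF K empty simple_compact_sections_Un])
  qed auto
qed

lemma measurable_projection:
  assumes fin: "finite_measure M" and X: "polish_topology X" and M: "sets M = sets (N \<Otimes>\<^sub>M borel_of_topology X)"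
    and E: "E \<in> sets M"
  obtains D where "D \<in> sets N" "D \<subseteq> fst ` E" "AE p in M. p \<in> E \<longrightarrow> fst p \<in> D"
proof -
  interpret finite_measure M by fact
  let ?K = "simple_compact_sections N X"
  have K: "?K \<subseteq> sets M"
    using simple_compact_sections_sets[OF X] M by auto
  have "\<forall>n. \<exists>C\<in>?K. C \<subseteq> E \<and> measure M (E - C) < 1 / Suc n"
    using inner_approx_simple_compact_sections[OF fin X M E] by (auto simp: inner_approx_def)
  then obtain C where C: "\<And>n. C n \<in> ?K" "\<And>n. C n \<subseteq> E" "\<And>n. measure M (E - C n) < 1 / Suc n"
    by metis
  have CM: "C n \<in> sets M" for n
    using C K by auto
  have "measure M (E - (\<Union>n. C n)) \<le> 1 / Suc n" for n
  proof -
    have "measure M (E - (\<Union>n. C n)) \<le> measure M (E - C n)"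
      using E CM by (intro finite_measure_mono) auto
    then show ?thesis
      using C(3)[of n] by linarith
  qed
  then have "measure M (E - (\<Union>n. C n)) \<le> 0"
    using LIMSEQ_inverse_real_of_nat by (intro LIMSEQ_le_const[of "\<lambda>n. inverse (real (Suc n))"]) (auto simp: inverse_eq_divide)
  then have "emeasure M (E - (\<Union>n. C n)) = 0"
    by (simp add: emeasure_eq_measure measure_nonneg antisym)
  then have "E - (\<Union>n. C n) \<in> null_sets M"
    using E CM by (auto intro!: null_setsI)
  then have "AE p in M. p \<notin> E - (\<Union>n. C n)"
    by (rule AE_not_in)
  then have "AE p in M. p \<in> E \<longrightarrow> fst p \<in> (\<Union>n. fst ` C n)"
    by eventually_elim auto
  moreover have "(\<Union>n. fst ` C n) \<in> sets N"
    using fst_simple_compact_sections[OF X C(1)] by auto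
  moreover have "(\<Union>n. fst ` C n) \<subseteq> fst ` E"
    using C(2) by blast
  ultimately show ?thesis
    using that by blast
qed

text \<open>The product over \<open>insert z J\<close> is viewed as a binary product with second
  factor \<open>N z\<close>, and \<open>measurable_projection\<close> is applied to the law of the
  pair (remaining coordinates, coordinate \<open>z\<close>).\<close>

lemma projection_coordinate:
  fixes N :: "'i \<Rightarrow> 'a measure"
  assumes fin: "finite_measure M" and X: "polish_topology X" and N: "N z = borel_of_topology X" and z: "z \<notin> J"
    and Y [measurable]: "Y \<in> measurable M (Pi\<^sub>M (insert z J) N)"
    and E [measurable]: "E \<in> sets (Pi\<^sub>M (insert z J) N)"
  obtains D where "D \<in> sets (Pi\<^sub>M J N)" "\<And>y. y \<in> D \<Longrightarrow> \<exists>x\<in>E. restrict x J = y"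
    "AE \<omega> in M. Y \<omega> \<in> E \<longrightarrow> restrict (Y \<omega>) J \<in> D"
proof -
  interpret finite_measure M by fact
  define h where "h \<omega> = (restrict (Y \<omega>) J, Y \<omega> z)" for \<omega>
  have "(\<lambda>x. restrict x J) \<in> measurable (Pi\<^sub>M (insert z J) N) (Pi\<^sub>M J N)"
    by (rule measurable_restrict_subset) auto
  then have "(\<lambda>\<omega>. restrict (Y \<omega>) J) \<in> measurable M (Pi\<^sub>M J N)"
    using Y by (rule measurable_compose[rotated])
  moreover have "(\<lambda>\<omega>. Y \<omega> z) \<in> measurable M (N z)"
    by (rule measurable_compose[OF Y measurable_component_singleton]) simp
  ultimately have h [measurable]: "h \<in> measurable M (Pi\<^sub>M J N \<Otimes>\<^sub>M N z)"
    unfolding h_def by (rule measurable_Pair)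
  let ?u = "\<lambda>(y, v). y(z := v)"
  have u [measurable]: "?u \<in> measurable (Pi\<^sub>M J N \<Otimes>\<^sub>M N z) (Pi\<^sub>M (insert z J) N)"
    by (rule measurable_add_dim)
  let ?E = "?u -` E \<inter> space (Pi\<^sub>M J N \<Otimes>\<^sub>M N z)"
  let ?\<mu> = "distr M (Pi\<^sub>M J N \<Otimes>\<^sub>M N z) h"
  have fm: "finite_measure ?\<mu>"
    by (rule finite_measure_distr) (rule h)
  have sm: "sets ?\<mu> = sets (Pi\<^sub>M J N \<Otimes>\<^sub>M borel_of_topology X)"
    by (simp add: N)
  have Em: "?E \<in> sets ?\<mu>"
    using measurable_sets[OF u E] by simp
  obtain D where D: "D \<in> sets (Pi\<^sub>M J N)" "D \<subseteq> fst ` ?E" "AE x in ?\<mu>. x \<in> ?E \<longrightarrow> fst x \<in> D"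
    by (rule measurable_projection[OF fm X sm Em]) (rule that)
  have "AE \<omega> in M. h \<omega> \<in> ?E \<longrightarrow> fst (h \<omega>) \<in> D"
    using D(3) by (rule AE_distrD[OF h])
  then have "AE \<omega> in M. Y \<omega> \<in> E \<longrightarrow> restrict (Y \<omega>) J \<in> D"
    using AE_space
  proof eventually_elim
    case (elim \<omega>)
    have "?u (h \<omega>) = Y \<omega>"
      using measurable_space[OF Y elim(2)] z by (auto simp: h_def space_PiM PiE_def extensional_def fun_eq_iff)
    then show ?case
      using elim measurable_space[OF h elim(2)] by (auto simp: h_def)
  qed
  moreover have "\<exists>x\<in>E. restrict x J = y" if "y \<in> D" for y
  proof -
    obtain v where v: "(y, v) \<in> ?E"
      using D(2) \<open>y \<in> D\<close> by auto
    then have "y \<in> space (Pi\<^sub>M J N)"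
      by (auto simp: space_pair_measure)
    then have "restrict (y(z := v)) J = y"
      using z by (auto simp: space_PiM PiE_def extensional_def fun_eq_iff)
    then show ?thesis
      using v by auto
  qed
  ultimately show ?thesis
    using that D(1) by blast
qed

text \<open>Coordinates are eliminated one at a time. Only single factors then have to be Polish,
  and no topology on a product is ever formed.\<close>

lemma projection_coordinates:
  fixes \<Omega> :: "'i \<Rightarrow> 'a topology"
  defines "N \<equiv> \<lambda>i. borel_of_topology (\<Omega> i)"
  assumes fin: "finite_measure M" and Z: "finite Z" "Z \<subseteq> V" and pol: "\<And>i. i \<in> Z \<Longrightarrow> polish_topology (\<Omega> i)"
    and X: "X \<in> measurable M (Pi\<^sub>M V N)" and E: "E \<in> sets (Pi\<^sub>M V N)"
  shows "\<exists>D\<in>sets (Pi\<^sub>M (V - Z) N). (\<forall>y\<in>D. \<exists>x\<in>E. restrict x (V - Z) = y) \<and>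
    (AE \<omega> in M. X \<omega> \<in> E \<longrightarrow> restrict (X \<omega>) (V - Z) \<in> D)"
  using Z pol
proof (induction Z rule: finite_induct)
  case empty
  have r: "restrict x V = x" if "x \<in> space (Pi\<^sub>M V N)" for x
    using that by (auto simp: space_PiM)
  have "AE \<omega> in M. X \<omega> \<in> E \<longrightarrow> restrict (X \<omega>) V \<in> E"
    using AE_space by eventually_elim (simp add: r measurable_space[OF X])
  moreover have "\<exists>x\<in>E. restrict x V = y" if "y \<in> E" for y
    using that r[of y] sets.sets_into_space[OF E] by blast
  ultimately show ?case
    unfolding Diff_empty using E by blast
next
  case (insert z Z)
  let ?J = "V - insert z Z"
  have J: "V - Z = insert z ?J" and zJ: "z \<notin> ?J" and JV: "?J \<subseteq> V - Z"
    using insert by auto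
  have "\<exists>D\<in>sets (Pi\<^sub>M (V - Z) N). (\<forall>y\<in>D. \<exists>x\<in>E. restrict x (V - Z) = y) \<and>
      (AE \<omega> in M. X \<omega> \<in> E \<longrightarrow> restrict (X \<omega>) (V - Z) \<in> D)"
    using insert.prems by (intro insert.IH) auto
  then obtain D where D: "D \<in> sets (Pi\<^sub>M (V - Z) N)" "\<And>y. y \<in> D \<Longrightarrow> \<exists>x\<in>E. restrict x (V - Z) = y"
      "AE \<omega> in M. X \<omega> \<in> E \<longrightarrow> restrict (X \<omega>) (V - Z) \<in> D"
    by blast
  have "(\<lambda>x. restrict x (V - Z)) \<in> measurable (Pi\<^sub>M V N) (Pi\<^sub>M (V - Z) N)"
    by (rule measurable_restrict_subset) auto
  then have Y: "(\<lambda>\<omega>. restrict (X \<omega>) (V - Z)) \<in> measurable M (Pi\<^sub>M (insert z ?J) N)"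
    using measurable_compose[OF X] J by simp
  have rr: "restrict (restrict x (V - Z)) ?J = restrict x ?J" for x :: "'i \<Rightarrow> 'a"
    using JV by (simp add: Int_absorb1)
  obtain D' where D': "D' \<in> sets (Pi\<^sub>M ?J N)" "\<And>y. y \<in> D' \<Longrightarrow> \<exists>x\<in>D. restrict x ?J = y"
      "AE \<omega> in M. restrict (X \<omega>) (V - Z) \<in> D \<longrightarrow> restrict (restrict (X \<omega>) (V - Z)) ?J \<in> D'"
  proof (rule projection_coordinate[OF fin _ _ zJ Y])
    show "polish_topology (\<Omega> z)" "N z = borel_of_topology (\<Omega> z)"
      using insert by (auto simp: N_def)
    show "D \<in> sets (Pi\<^sub>M (insert z ?J) N)"
      using D(1) J by simp
  qed (rule that)
  have "AE \<omega> in M. X \<omega> \<in> E \<longrightarrow> restrict (X \<omega>) ?J \<in> D'"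
    using D(3) D'(3) unfolding rr by eventually_elim blast
  moreover have "\<exists>x\<in>E. restrict x ?J = y" if "y \<in> D'" for y
    using D'(2)[OF that] D(2) rr by metis
  ultimately show ?case
    using D'(1) by blast
qed

text \<open>\<open>g\<close> replaces the infimum of \<open>f\<close> over the coordinates in
  \<open>Z\<close>, as the infimum of the rationals \<open>q\<close> whose sublevel set projects
  onto \<open>y\<close>. The two inequalities use the two halves of the projection lemma:
  \<open>g \<le> f\<close> holds because \<open>X \<omega> \<in> E q\<close> almost surely puts the
  restriction into \<open>D q\<close>, and \<open>f \<le> g + (\<Sum>i\<in>Z. c i)\<close> because
  every point of \<open>D q\<close> is the restriction of a genuine point of \<open>E q\<close>, to
  which the Lipschitz bound applies.\<close>

lemma lipschitz_sandwich:
  fixes \<Omega> :: "'i \<Rightarrow> 'a topology"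
  defines "N \<equiv> \<lambda>i. borel_of_topology (\<Omega> i)"
  assumes fin: "finite_measure M" and V: "finite V" and Z: "Z \<subseteq> V" and pol: "\<And>i. i \<in> V \<Longrightarrow> polish_topology (\<Omega> i)"
    and X: "X \<in> measurable M (Pi\<^sub>M V N)" and f: "f \<in> borel_measurable (Pi\<^sub>M V N)"
    and lip: "lipschitz_wrt V (\<lambda>i. topspace (\<Omega> i)) c f"
    and c: "\<And>i. i \<in> V \<Longrightarrow> 0 \<le> c i"
    and B: "\<And>x. x \<in> space (Pi\<^sub>M V N) \<Longrightarrow> \<bar>f x\<bar> \<le> B"
  obtains g where "g \<in> borel_measurable (Pi\<^sub>M (V - Z) N)" "\<And>y. \<bar>g y\<bar> \<le> \<bar>B\<bar>"
    "AE \<omega> in M. g (restrict (X \<omega>) (V - Z)) \<le> f (X \<omega>) \<and>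
       f (X \<omega>) \<le> g (restrict (X \<omega>) (V - Z)) + (\<Sum>i\<in>Z. c i)"
proof -
  define E where "E q = {x \<in> space (Pi\<^sub>M V N). f x \<le> of_rat q}" for q
  have Em: "E q \<in> sets (Pi\<^sub>M V N)" for q
    using f unfolding E_def by measurable
  have "\<exists>D\<in>sets (Pi\<^sub>M (V - Z) N). (\<forall>y\<in>D. \<exists>x\<in>E q. restrict x (V - Z) = y) \<and>
      (AE \<omega> in M. X \<omega> \<in> E q \<longrightarrow> restrict (X \<omega>) (V - Z) \<in> D)" for q
    unfolding N_def
  proof (rule projection_coordinates[OF fin finite_subset[OF Z V] Z])
    show "polish_topology (\<Omega> i)" if "i \<in> Z" for i
      using that pol Z by auto
    show "X \<in> measurable M (Pi\<^sub>M V (\<lambda>i. borel_of_topology (\<Omega> i)))"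
      using X by (simp only: N_def)
    show "E q \<in> sets (Pi\<^sub>M V (\<lambda>i. borel_of_topology (\<Omega> i)))"
      using Em by (simp only: N_def)
  qed
  then have "\<forall>q. \<exists>D. D \<in> sets (Pi\<^sub>M (V - Z) N) \<and> (\<forall>y\<in>D. \<exists>x\<in>E q. restrict x (V - Z) = y) \<and>
      (AE \<omega> in M. X \<omega> \<in> E q \<longrightarrow> restrict (X \<omega>) (V - Z) \<in> D)"
    by blast
  from choice[OF this] obtain D where DD: "\<And>q. D q \<in> sets (Pi\<^sub>M (V - Z) N) \<and> (\<forall>y\<in>D q. \<exists>x\<in>E q. restrict x (V - Z) = y) \<and>
      (AE \<omega> in M. X \<omega> \<in> E q \<longrightarrow> restrict (X \<omega>) (V - Z) \<in> D q)"
    by blast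
  then have D: "\<And>q. D q \<in> sets (Pi\<^sub>M (V - Z) N)"
      "\<And>q y. y \<in> D q \<Longrightarrow> \<exists>x\<in>E q. restrict x (V - Z) = y"
      "\<And>q. AE \<omega> in M. X \<omega> \<in> E q \<longrightarrow> restrict (X \<omega>) (V - Z) \<in> D q"
    by blast+
  \<comment> \<open>Clipping to \<open>[-\<bar>B\<bar>, \<bar>B\<bar>]\<close>, with default
    \<open>\<bar>B\<bar>\<close> outside \<open>D q\<close>, makes the infimum exist and keeps
    \<open>g\<close> bounded everywhere, not only almost everywhere.\<close>
  define h where "h q y = (if y \<in> D q then min \<bar>B\<bar> (max (of_rat q) (-\<bar>B\<bar>)) else \<bar>B\<bar>)" for q y
  define g where "g y = (INF q. h q y)" for y
  have h: "- \<bar>B\<bar> \<le> h q y" "h q y \<le> \<bar>B\<bar>" for q y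
    by (auto simp: h_def)
  have bdd: "bdd_below (range (\<lambda>q. h q y))" for y
    using h by (intro bdd_belowI[of _ "-\<bar>B\<bar>"]) auto
  have g_le: "g y \<le> h q y" for q y
    unfolding g_def using bdd by (intro cINF_lower) auto
  have g_ge: "b \<le> g y" if "\<And>q. b \<le> h q y" for b y
    unfolding g_def using that by (intro cINF_greatest) auto
  have hm: "h q \<in> borel_measurable (Pi\<^sub>M (V - Z) N)" for q
    using D(1)[of q] unfolding h_def by measurable
  have "g \<in> borel_measurable (Pi\<^sub>M (V - Z) N)"
    unfolding g_def using hm by (intro borel_measurable_cINF_real) auto
  moreover have "\<bar>g y\<bar> \<le> \<bar>B\<bar>" for y
    using g_ge[of "-\<bar>B\<bar>" y] h g_le[of y 0] order_trans[OF g_le[of y 0] h(2)] by (simp add: abs_le_iff)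
  moreover have "AE \<omega> in M. g (restrict (X \<omega>) (V - Z)) \<le> f (X \<omega>) \<and>
       f (X \<omega>) \<le> g (restrict (X \<omega>) (V - Z)) + (\<Sum>i\<in>Z. c i)"
  proof -
    \<comment> \<open>Rational levels give countably many exceptional null sets, so all levels can
      be used at the same \<open>\<omega>\<close>.\<close>
    have "AE \<omega> in M. \<forall>q. X \<omega> \<in> E q \<longrightarrow> restrict (X \<omega>) (V - Z) \<in> D q"
      using D(3) by (simp add: AE_all_countable)
    then show ?thesis
      using AE_space
    proof eventually_elim
      case (elim \<omega>)
      let ?x = "X \<omega>" and ?y = "restrict (X \<omega>) (V - Z)"
      have x: "?x \<in> space (Pi\<^sub>M V N)"
        using measurable_space[OF X elim(2)] .
      have sum0: "0 \<le> (\<Sum>i\<in>Z. c i)"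
        using c Z by (intro sum_nonneg) auto
      have fB: "f ?x \<le> \<bar>B\<bar>"
        using B[OF x] by linarith
      have "g ?y \<le> f ?x"
      proof (rule ccontr)
        assume "\<not> g ?y \<le> f ?x"
        then obtain q where q: "f ?x < of_rat q" "of_rat q < g ?y"
          using of_rat_dense[of "f ?x" "g ?y"] by auto
        then have "?y \<in> D q"
          using elim x by (auto simp: E_def)
        then have "g ?y \<le> max (of_rat q) (-\<bar>B\<bar>)"
          using g_le[of ?y q] by (simp add: h_def)
        then show False
          using q B[OF x] by linarith
      qed
      moreover have "f ?x - (\<Sum>i\<in>Z. c i) \<le> g ?y"
      proof (rule g_ge)
        fix q
        show "f ?x - (\<Sum>i\<in>Z. c i) \<le> h q ?y"
        proof (cases "?y \<in> D q")
          case True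
          then obtain x' where x': "x' \<in> E q" "restrict x' (V - Z) = ?y"
            using D(2) by blast
          have "\<bar>f ?x - f x'\<bar> \<le> (\<Sum>i\<in>V. c i * of_bool (?x i \<noteq> x' i))"
            using lip x x'(1) unfolding lipschitz_wrt_def by (auto simp: E_def space_PiM N_def)
          also have "\<dots> \<le> (\<Sum>i\<in>V. if i \<in> Z then c i else 0)"
          proof (rule sum_mono)
            fix i assume "i \<in> V"
            then show "c i * of_bool (?x i \<noteq> x' i) \<le> (if i \<in> Z then c i else 0)"
              using c[of i] fun_cong[OF x'(2), of i] by auto
          qed
          also have "\<dots> = (\<Sum>i\<in>Z. c i)"
            using V Z by (simp add: sum.If_cases Int_absorb1)
          finally have "f ?x \<le> f x' + (\<Sum>i\<in>Z. c i)"
            by linarith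
          moreover have "f x' \<le> of_rat q"
            using x' by (simp add: E_def)
          ultimately have "f ?x - (\<Sum>i\<in>Z. c i) \<le> of_rat q"
            by linarith
          then show ?thesis
            using True fB sum0 by (simp add: h_def le_max_iff_disj)
        qed (use fB sum0 in \<open>simp add: h_def\<close>)
      qed
      ultimately show ?case
        by simp
    qed
  qed
  ultimately show ?thesis
    by (rule that)
qed

section \<open>Conditional independence and conditional Hoeffding\<close>

text \<open>Given \<open>q W\<close>, the independent \<open>U\<close> says nothing more about \<open>W\<close>: the conditional expectation of
  \<open>g (p U, W)\<close> given \<open>(U, q W)\<close> is a function \<open>l\<close> of \<open>(p U, q W)\<close>.\<close>

lemma cond_indep_density:
  fixes g :: "'c \<times> 'd \<Rightarrow> ennreal" and B :: real
  assumes "prob_space M" and indep: "prob_space.indep_var M MU U MW W"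
    and p [measurable]: "p \<in> measurable MU MP" and q [measurable]: "q \<in> measurable MW MR"
    and g [measurable]: "g \<in> borel_measurable (MP \<Otimes>\<^sub>M MW)" and gB: "\<And>x. g x \<le> ennreal B"
  shows "\<exists>l\<in>borel_measurable (MP \<Otimes>\<^sub>M MR). \<forall>A\<in>sets (MU \<Otimes>\<^sub>M MR).
      (\<integral>\<^sup>+\<omega>. g (p (U \<omega>), W \<omega>) * indicator A (U \<omega>, q (W \<omega>)) \<partial>M) =
      (\<integral>\<^sup>+\<omega>. l (p (U \<omega>), q (W \<omega>)) * indicator A (U \<omega>, q (W \<omega>)) \<partial>M)"
proof -
  interpret prob_space M by fact
  have U [measurable]: "U \<in> measurable M MU" and W [measurable]: "W \<in> measurable M MW"
    using indep_var_rv1[OF indep] indep_var_rv2[OF indep] by auto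
  define PU where "PU = distr M MU U"
  define PW where "PW = distr M MW W"
  have [measurable_cong]: "sets PU = sets MU" "sets PW = sets MW"
    by (simp_all add: PU_def PW_def)
  interpret PU: prob_space PU
    unfolding PU_def by (rule prob_space_distr) measurable
  interpret PW: prob_space PW
    unfolding PW_def by (rule prob_space_distr) measurable
  interpret P: pair_sigma_finite PU PW ..
  have joint: "(\<integral>\<^sup>+\<omega>. k (U \<omega>, W \<omega>) \<partial>M) = (\<integral>\<^sup>+u. \<integral>\<^sup>+w. k (u, w) \<partial>PW \<partial>PU)"
    if [measurable]: "k \<in> borel_measurable (MU \<Otimes>\<^sub>M MW)" for k :: "_ \<Rightarrow> ennreal"
  proof -
    have "(\<integral>\<^sup>+\<omega>. k (U \<omega>, W \<omega>) \<partial>M) = (\<integral>\<^sup>+z. k z \<partial>distr M (MU \<Otimes>\<^sub>M MW) (\<lambda>\<omega>. (U \<omega>, W \<omega>)))"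
      by (subst nn_integral_distr) auto
    also have "distr M (MU \<Otimes>\<^sub>M MW) (\<lambda>\<omega>. (U \<omega>, W \<omega>)) = PU \<Otimes>\<^sub>M PW"
      using indep unfolding indep_var_distribution_eq PU_def PW_def by simp
    also have "(\<integral>\<^sup>+z. k z \<partial>(PU \<Otimes>\<^sub>M PW)) = (\<integral>\<^sup>+u. \<integral>\<^sup>+w. k (u, w) \<partial>PW \<partial>PU)"
      by (rule PW.nn_integral_fst[symmetric]) measurable
    finally show ?thesis .
  qed
  define r where "r \<omega> = (p (U \<omega>), q (W \<omega>))" for \<omega>
  have r [measurable]: "r \<in> measurable M (MP \<Otimes>\<^sub>M MR)"
    unfolding r_def by measurable
  define \<rho> where "\<rho> = distr M (MP \<Otimes>\<^sub>M MR) r"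
  define \<nu> where "\<nu> = distr (density M (\<lambda>\<omega>. g (p (U \<omega>), W \<omega>))) (MP \<Otimes>\<^sub>M MR) r"
  have [measurable_cong]: "sets \<rho> = sets (MP \<Otimes>\<^sub>M MR)"
    by (simp add: \<rho>_def)
  interpret R: prob_space \<rho>
    unfolding \<rho>_def by (rule prob_space_distr) measurable
  have \<nu>: "emeasure \<nu> A = (\<integral>\<^sup>+\<omega>. g (p (U \<omega>), W \<omega>) * indicator A (r \<omega>) \<partial>M)"
    if [measurable]: "A \<in> sets (MP \<Otimes>\<^sub>M MR)" for A
  proof -
    have "emeasure \<nu> A = (\<integral>\<^sup>+\<omega>. g (p (U \<omega>), W \<omega>) * indicator (r -` A \<inter> space M) \<omega> \<partial>M)"
      unfolding \<nu>_def by (subst emeasure_distr) (auto simp: emeasure_density)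
    also have "\<dots> = (\<integral>\<^sup>+\<omega>. g (p (U \<omega>), W \<omega>) * indicator A (r \<omega>) \<partial>M)"
      by (intro nn_integral_cong) (auto simp: indicator_def)
    finally show ?thesis .
  qed
  have "absolutely_continuous \<rho> \<nu>"
    unfolding absolutely_continuous_def
  proof
    fix A assume A: "A \<in> null_sets \<rho>"
    then have [measurable]: "A \<in> sets (MP \<Otimes>\<^sub>M MR)"
      by (auto simp: \<rho>_def)
    have "emeasure M (r -` A \<inter> space M) = 0"
      using A by (auto simp: \<rho>_def emeasure_distr null_sets_def)
    then have "AE \<omega> in M. \<omega> \<notin> r -` A \<inter> space M"
      by (intro AE_not_in null_setsI) auto
    then have "AE \<omega> in M. g (p (U \<omega>), W \<omega>) * indicator A (r \<omega>) = 0"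
      using AE_space by eventually_elim auto
    then have "emeasure \<nu> A = 0"
      by (simp add: \<nu> nn_integral_0_iff_AE)
    then show "A \<in> null_sets \<nu>"
      by (intro null_setsI) (auto simp: \<nu>_def)
  qed
  \<comment> \<open>\<open>l (r \<omega>)\<close> is the conditional expectation of
    \<open>g (p U, W)\<close> given \<open>r = (p U, q W)\<close>, obtained as a Radon-Nikodym
    density on the image space; \<open>base\<close> is its defining property.\<close>
  define l where "l = RN_deriv \<rho> \<nu>"
  have l [measurable]: "l \<in> borel_measurable (MP \<Otimes>\<^sub>M MR)"
    using borel_measurable_RN_deriv[of \<rho> \<nu>] unfolding l_def by measurable
  have dens: "density \<rho> l = \<nu>"
    unfolding l_def by (rule R.density_RN_deriv) (fact, simp add: \<nu>_def \<rho>_def)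
  have base: "(\<integral>\<^sup>+\<omega>. g (p (U \<omega>), W \<omega>) * indicator A (r \<omega>) \<partial>M) = (\<integral>\<^sup>+\<omega>. l (r \<omega>) * indicator A (r \<omega>) \<partial>M)"
    if [measurable]: "A \<in> sets (MP \<Otimes>\<^sub>M MR)" for A
  proof -
    have "emeasure \<nu> A = (\<integral>\<^sup>+x. l x * indicator A x \<partial>\<rho>)"
      unfolding dens[symmetric] by (subst emeasure_density) auto
    also have "\<dots> = (\<integral>\<^sup>+\<omega>. l (r \<omega>) * indicator A (r \<omega>) \<partial>M)"
      unfolding \<rho>_def by (subst nn_integral_distr) auto
    finally show ?thesis
      by (simp add: \<nu>)
  qed
  define PP where "PP = distr PU MP p"
  have [measurable_cong]: "sets PP = sets MP"
    by (simp add: PP_def)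
  interpret PP: prob_space PP
    unfolding PP_def by (rule PU.prob_space_distr) measurable
  \<comment> \<open>For fixed \<open>b\<close>, independence integrates \<open>W\<close> out and
    leaves functions \<open>G\<close> and \<open>H\<close> of \<open>p u\<close> alone. Testing with
    preimages under \<open>p\<close>, which \<open>base\<close> permits, already forces
    \<open>G = H\<close> almost everywhere for the law of \<open>p U\<close>; hence the integrals
    agree on every \<open>a\<close> in \<open>MU\<close>, not just on such preimages.\<close>
  have rect: "(\<integral>\<^sup>+\<omega>. g (p (U \<omega>), W \<omega>) * indicator (a \<times> b) (U \<omega>, q (W \<omega>)) \<partial>M) =
      (\<integral>\<^sup>+\<omega>. l (r \<omega>) * indicator (a \<times> b) (U \<omega>, q (W \<omega>)) \<partial>M)"
    if a [measurable]: "a \<in> sets MU" and b [measurable]: "b \<in> sets MR" for a b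
  proof -
    define G where "G x = (\<integral>\<^sup>+w. g (x, w) * indicator b (q w) \<partial>PW)" for x
    define H where "H x = (\<integral>\<^sup>+w. l (x, q w) * indicator b (q w) \<partial>PW)" for x
    have [measurable]: "G \<in> borel_measurable MP" "H \<in> borel_measurable MP"
      unfolding G_def H_def by measurable
    have G: "(\<integral>\<^sup>+\<omega>. g (p (U \<omega>), W \<omega>) * indicator (c \<times> b) (U \<omega>, q (W \<omega>)) \<partial>M) =
        (\<integral>\<^sup>+u. G (p u) * indicator c u \<partial>PU)" if [measurable]: "c \<in> sets MU" for c
    proof -
      have "(\<integral>\<^sup>+\<omega>. g (p (U \<omega>), W \<omega>) * indicator (c \<times> b) (U \<omega>, q (W \<omega>)) \<partial>M) =
          (\<integral>\<^sup>+u. \<integral>\<^sup>+w. (g (p u, w) * indicator b (q w)) * indicator c u \<partial>PW \<partial>PU)"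
      proof -
        define k where "k = (\<lambda>(u, w). (g (p u, w) * indicator b (q w)) * (indicator c u :: ennreal))"
        have "(\<integral>\<^sup>+\<omega>. g (p (U \<omega>), W \<omega>) * indicator (c \<times> b) (U \<omega>, q (W \<omega>)) \<partial>M) = (\<integral>\<^sup>+\<omega>. k (U \<omega>, W \<omega>) \<partial>M)"
          by (intro nn_integral_cong) (auto simp: k_def indicator_def)
        also have "\<dots> = (\<integral>\<^sup>+u. \<integral>\<^sup>+w. k (u, w) \<partial>PW \<partial>PU)"
          by (rule joint) (unfold k_def, measurable)
        finally show ?thesis
          by (simp add: k_def)
      qed
      also have "\<dots> = (\<integral>\<^sup>+u. G (p u) * indicator c u \<partial>PU)"
        unfolding G_def by (intro nn_integral_cong nn_integral_multc) (auto simp: PU_def dest: measurable_space[OF p])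
      finally show ?thesis .
    qed
    have H: "(\<integral>\<^sup>+\<omega>. l (r \<omega>) * indicator (c \<times> b) (U \<omega>, q (W \<omega>)) \<partial>M) =
        (\<integral>\<^sup>+u. H (p u) * indicator c u \<partial>PU)" if [measurable]: "c \<in> sets MU" for c
    proof -
      have "(\<integral>\<^sup>+\<omega>. l (r \<omega>) * indicator (c \<times> b) (U \<omega>, q (W \<omega>)) \<partial>M) =
          (\<integral>\<^sup>+u. \<integral>\<^sup>+w. (l (p u, q w) * indicator b (q w)) * indicator c u \<partial>PW \<partial>PU)"
      proof -
        define k where "k = (\<lambda>(u, w). (l (p u, q w) * indicator b (q w)) * (indicator c u :: ennreal))"
        have "(\<integral>\<^sup>+\<omega>. l (r \<omega>) * indicator (c \<times> b) (U \<omega>, q (W \<omega>)) \<partial>M) = (\<integral>\<^sup>+\<omega>. k (U \<omega>, W \<omega>) \<partial>M)"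
          by (intro nn_integral_cong) (auto simp: k_def indicator_def r_def)
        also have "\<dots> = (\<integral>\<^sup>+u. \<integral>\<^sup>+w. k (u, w) \<partial>PW \<partial>PU)"
          by (rule joint) (unfold k_def, measurable)
        finally show ?thesis
          by (simp add: k_def)
      qed
      also have "\<dots> = (\<integral>\<^sup>+u. H (p u) * indicator c u \<partial>PU)"
        unfolding H_def by (intro nn_integral_cong nn_integral_multc) (auto simp: PU_def dest: measurable_space[OF p])
      finally show ?thesis .
    qed
    have "density PP G = density PP H"
    proof (rule measure_eqI)
      fix A assume "A \<in> sets (density PP G)"
      then have A [measurable]: "A \<in> sets MP"
        by (simp add: PP_def)
      let ?c = "p -` A \<inter> space MU"
      have c [measurable]: "?c \<in> sets MU"
        by measurable
      have ind: "indicator (?c \<times> b) (U \<omega>, q (W \<omega>)) = (indicator (A \<times> b) (r \<omega>) :: ennreal)"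
        if "\<omega> \<in> space M" for \<omega>
        using measurable_space[OF U that] by (auto simp: r_def indicator_def)
      have "emeasure (density PP G) A = (\<integral>\<^sup>+u. G (p u) * indicator A (p u) \<partial>PU)"
        by (simp add: emeasure_density, simp add: PP_def nn_integral_distr)
      also have "\<dots> = (\<integral>\<^sup>+u. G (p u) * indicator ?c u \<partial>PU)"
        by (intro nn_integral_cong) (auto simp: indicator_def PU_def)
      also have "\<dots> = (\<integral>\<^sup>+\<omega>. g (p (U \<omega>), W \<omega>) * indicator (A \<times> b) (r \<omega>) \<partial>M)"
        unfolding G[OF c, symmetric] by (intro nn_integral_cong) (simp add: ind)
      also have "\<dots> = (\<integral>\<^sup>+\<omega>. l (r \<omega>) * indicator (A \<times> b) (r \<omega>) \<partial>M)"
        by (rule base) measurable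
      also have "\<dots> = (\<integral>\<^sup>+u. H (p u) * indicator ?c u \<partial>PU)"
        unfolding H[OF c, symmetric] by (intro nn_integral_cong) (simp add: ind)
      also have "\<dots> = (\<integral>\<^sup>+u. H (p u) * indicator A (p u) \<partial>PU)"
        by (intro nn_integral_cong) (auto simp: indicator_def PU_def)
      also have "\<dots> = emeasure (density PP H) A"
        by (simp add: emeasure_density, simp add: PP_def nn_integral_distr)
      finally show "emeasure (density PP G) A = emeasure (density PP H) A" .
    qed simp
    then have "AE x in PP. G x = H x"
      by (intro PP.density_unique) measurable
    then have "AE u in PU. G (p u) = H (p u)"
      unfolding PP_def by (subst (asm) AE_distr_iff) auto
    then have "(\<integral>\<^sup>+u. G (p u) * indicator a u \<partial>PU) = (\<integral>\<^sup>+u. H (p u) * indicator a u \<partial>PU)"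
      by (intro nn_integral_cong_AE) auto
    then show ?thesis
      using G[OF a] H[OF a] by simp
  qed
  define s where "s \<omega> = (U \<omega>, q (W \<omega>))" for \<omega>
  have s [measurable]: "s \<in> measurable M (MU \<Otimes>\<^sub>M MR)"
    unfolding s_def by measurable
  have law: "emeasure (distr (density M k) (MU \<Otimes>\<^sub>M MR) s) A = (\<integral>\<^sup>+\<omega>. k \<omega> * indicator A (s \<omega>) \<partial>M)"
    if [measurable]: "k \<in> borel_measurable M" "A \<in> sets (MU \<Otimes>\<^sub>M MR)" for k A
  proof -
    have "emeasure (distr (density M k) (MU \<Otimes>\<^sub>M MR) s) A = (\<integral>\<^sup>+\<omega>. k \<omega> * indicator (s -` A \<inter> space M) \<omega> \<partial>M)"
      by (subst emeasure_distr) (auto simp: emeasure_density)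
    also have "\<dots> = (\<integral>\<^sup>+\<omega>. k \<omega> * indicator A (s \<omega>) \<partial>M)"
      by (intro nn_integral_cong) (auto simp: indicator_def)
    finally show ?thesis .
  qed
  let ?\<mu> = "distr (density M (\<lambda>\<omega>. g (p (U \<omega>), W \<omega>))) (MU \<Otimes>\<^sub>M MR) s"
  let ?\<mu>' = "distr (density M (\<lambda>\<omega>. l (r \<omega>))) (MU \<Otimes>\<^sub>M MR) s"
  \<comment> \<open>Rectangles form an intersection-stable generator, and boundedness of
    \<open>g\<close> makes the total mass finite, so agreement on rectangles determines the
    measures.\<close>
  have eq: "?\<mu> = ?\<mu>'"
  proof (rule measure_eqI_generator_eq)
    let ?E = "{a \<times> b | a b. a \<in> sets MU \<and> b \<in> sets MR}"
    show "Int_stable ?E"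
      by (rule Int_stable_pair_measure_generator)
    show "?E \<subseteq> Pow (space MU \<times> space MR)"
      by (rule pair_measure_closed)
    show "sets ?\<mu> = sigma_sets (space MU \<times> space MR) ?E" "sets ?\<mu>' = sigma_sets (space MU \<times> space MR) ?E"
      by (simp_all add: sets_pair_measure)
    show "range (\<lambda>_::nat. space MU \<times> space MR) \<subseteq> ?E"
      by auto
    show "(\<Union>i::nat. space MU \<times> space MR) = space MU \<times> space MR"
      by simp
    fix A assume "A \<in> ?E"
    then obtain a b where A: "A = a \<times> b" and [measurable]: "a \<in> sets MU" "b \<in> sets MR"
      by auto
    show "emeasure ?\<mu> A = emeasure ?\<mu>' A"
      using rect[of a b] by (simp add: law A, simp add: s_def)
  next
    have "emeasure ?\<mu> (space MU \<times> space MR) =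
        (\<integral>\<^sup>+\<omega>. g (p (U \<omega>), W \<omega>) * indicator (space MU \<times> space MR) (s \<omega>) \<partial>M)"
      by (rule law) auto
    also have "\<dots> \<le> (\<integral>\<^sup>+\<omega>. ennreal B \<partial>M)"
    proof (rule nn_integral_mono)
      show "g (p (U \<omega>), W \<omega>) * indicator (space MU \<times> space MR) (s \<omega>) \<le> ennreal B" for \<omega>
        using gB[of "(p (U \<omega>), W \<omega>)"] by (simp split: split_indicator)
    qed
    also have "\<dots> < \<infinity>"
      by (simp add: emeasure_space_1)
    finally show "emeasure ?\<mu> (space MU \<times> space MR) \<noteq> \<infinity>"
      by simp
  qed
  show ?thesis
  proof (intro bexI[OF _ l] ballI)
    fix A assume [measurable]: "A \<in> sets (MU \<Otimes>\<^sub>M MR)"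
    show "(\<integral>\<^sup>+\<omega>. g (p (U \<omega>), W \<omega>) * indicator A (U \<omega>, q (W \<omega>)) \<partial>M) =
        (\<integral>\<^sup>+\<omega>. l (p (U \<omega>), q (W \<omega>)) * indicator A (U \<omega>, q (W \<omega>)) \<partial>M)"
      using law[of "\<lambda>\<omega>. g (p (U \<omega>), W \<omega>)" A] law[of "\<lambda>\<omega>. l (r \<omega>)" A] eq
      by (simp add: s_def r_def)
  qed
qed

lemma (in prob_space) sigma_finite_subalgebraI:
  assumes "subalgebra M F"
  shows "sigma_finite_subalgebra M F"
proof -
  interpret finite_measure_subalgebra M F
    by unfold_locales fact
  show ?thesis ..
qed

text \<open>\<open>F\<close> stands for what is known after a step and \<open>F'\<close> for what
  was known before. The function \<open>l\<close> of \<open>cond_indep_density\<close> integrates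
  like \<open>g + B\<close> over every event of \<open>F\<close>, so it is a conditional expectation
  given \<open>F\<close>; yet it depends on \<open>(p U, q W)\<close> only, which is already
  measurable for \<open>F'\<close>.\<close>

lemma (in prob_space) real_cond_exp_reduce:
  fixes g :: "'c \<times> 'd \<Rightarrow> real"
  assumes indep: "indep_var MU U MW W"
    and p [measurable]: "p \<in> measurable MU MP" and q [measurable]: "q \<in> measurable MW MR"
    and g [measurable]: "g \<in> borel_measurable (MP \<Otimes>\<^sub>M MW)" and gB: "\<And>x. \<bar>g x\<bar> \<le> B"
    and F: "subalgebra M F" and F': "subalgebra F F'"
    and FA: "\<And>A. A \<in> sets F \<Longrightarrow> \<exists>A'\<in>sets (MU \<Otimes>\<^sub>M MR). A = {\<omega>\<in>space M. (U \<omega>, q (W \<omega>)) \<in> A'}"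
    and r: "(\<lambda>\<omega>. (p (U \<omega>), q (W \<omega>))) \<in> measurable F' (MP \<Otimes>\<^sub>M MR)"
  obtains L where "L \<in> borel_measurable F'"
    "AE \<omega> in M. real_cond_exp M F (\<lambda>\<omega>. g (p (U \<omega>), W \<omega>)) \<omega> = L \<omega>"
proof -
  interpret S: sigma_finite_subalgebra M F
    using F by (rule sigma_finite_subalgebraI)
  have [measurable]: "U \<in> measurable M MU" "W \<in> measurable M MW"
    using indep_var_rv1[OF indep] indep_var_rv2[OF indep] by auto
  let ?g = "\<lambda>\<omega>. g (p (U \<omega>), W \<omega>)"
  have nonneg: "0 \<le> g x + B" for x
    using gB[of x] by linarith
  have "ennreal (g x + B) \<le> ennreal (2 * B)" for x
    using gB[of x] by (intro ennreal_leI) linarith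
  then have "\<exists>l\<in>borel_measurable (MP \<Otimes>\<^sub>M MR). \<forall>A\<in>sets (MU \<Otimes>\<^sub>M MR).
      (\<integral>\<^sup>+\<omega>. ennreal (?g \<omega> + B) * indicator A (U \<omega>, q (W \<omega>)) \<partial>M) =
      (\<integral>\<^sup>+\<omega>. l (p (U \<omega>), q (W \<omega>)) * indicator A (U \<omega>, q (W \<omega>)) \<partial>M)"
    by (intro cond_indep_density[OF prob_space_axioms indep p q, of "\<lambda>x. ennreal (g x + B)" "2 * B"]) auto
  then obtain l where l [measurable]: "l \<in> borel_measurable (MP \<Otimes>\<^sub>M MR)"
    and eq: "\<And>A. A \<in> sets (MU \<Otimes>\<^sub>M MR) \<Longrightarrow>
      (\<integral>\<^sup>+\<omega>. ennreal (?g \<omega> + B) * indicator A (U \<omega>, q (W \<omega>)) \<partial>M) =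
      (\<integral>\<^sup>+\<omega>. l (p (U \<omega>), q (W \<omega>)) * indicator A (U \<omega>, q (W \<omega>)) \<partial>M)"
    by blast
  have lF': "(\<lambda>\<omega>. l (p (U \<omega>), q (W \<omega>))) \<in> borel_measurable F'"
    using measurable_compose[OF r l] by simp
  have "AE \<omega> in M. nn_cond_exp M F (\<lambda>\<omega>. ennreal (?g \<omega> + B)) \<omega> = l (p (U \<omega>), q (W \<omega>))"
  proof (rule AE_symmetric, rule S.nn_cond_exp_charact)
    fix A assume "A \<in> sets F"
    then obtain A' where A': "A' \<in> sets (MU \<Otimes>\<^sub>M MR)" "A = {\<omega>\<in>space M. (U \<omega>, q (W \<omega>)) \<in> A'}"
      using FA by blast
    have "indicator A \<omega> = (indicator A' (U \<omega>, q (W \<omega>)) :: ennreal)" if "\<omega> \<in> space M" for \<omega>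
      using that A' by (auto simp: indicator_def)
    then show "(\<integral>\<^sup>+\<omega>\<in>A. ennreal (?g \<omega> + B) \<partial>M) = (\<integral>\<^sup>+\<omega>\<in>A. l (p (U \<omega>), q (W \<omega>)) \<partial>M)"
      using eq[OF A'(1)] by (simp cong: nn_integral_cong)
  next
    show "(\<lambda>\<omega>. l (p (U \<omega>), q (W \<omega>))) \<in> borel_measurable F"
      using lF' F' by (rule measurable_from_subalg[rotated])
  qed measurable
  \<comment> \<open>\<open>real_cond_exp\<close> subtracts the conditional expectation of the
    negative part, and the shift by \<open>B\<close> makes that part vanish.\<close>
  moreover have "AE \<omega> in M. nn_cond_exp M F (\<lambda>\<omega>. ennreal (- (?g \<omega> + B))) \<omega> = 0"
  proof -
    have "(\<lambda>\<omega>. ennreal (- (?g \<omega> + B))) = (\<lambda>_. 0)"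
    proof (intro ext ennreal_neg)
      show "- (?g \<omega> + B) \<le> 0" for \<omega>
        using nonneg[of "(p (U \<omega>), W \<omega>)"] by simp
    qed
    then show ?thesis
      using AE_symmetric[OF S.nn_cond_exp_F_meas[of "\<lambda>_. 0"]] by simp
  qed
  moreover have int: "integrable M ?g"
    using gB by (intro integrable_const_bound[where B = B]) auto
  then have "AE \<omega> in M. real_cond_exp M F (\<lambda>\<omega>. ?g \<omega> + B) \<omega> = real_cond_exp M F ?g \<omega> + real_cond_exp M F (\<lambda>_. B) \<omega>"
    by (intro S.real_cond_exp_add) auto
  moreover have "AE \<omega> in M. real_cond_exp M F (\<lambda>_. B) \<omega> = B"
    by (intro S.real_cond_exp_F_meas) auto
  ultimately have "AE \<omega> in M. real_cond_exp M F ?g \<omega> = enn2real (l (p (U \<omega>), q (W \<omega>))) - B"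
    by eventually_elim (auto simp: real_cond_exp_def)
  moreover have "(\<lambda>\<omega>. enn2real (l (p (U \<omega>), q (W \<omega>))) - B) \<in> borel_measurable F'"
    using lF' by measurable
  ultimately show ?thesis
    using that by blast
qed

text \<open>On the interval \<open>[a, a + d]\<close>, the exponential lies below its chord, whose value at \<open>0\<close> is bounded by
  the two-point case of Hoeffding's lemma. For \<open>d = 0\<close> the slope is the junk value \<open>0\<close>, and \<open>y = 0\<close>.\<close>

lemma exp_le_chord:
  fixes l d a y :: real
  assumes l: "0 \<le> l" and d: "0 \<le> d" and a: "- d \<le> a" "a \<le> 0" and y: "a \<le> y" "y \<le> a + d"
  shows "exp (l * y) \<le> exp (l\<^sup>2 * d\<^sup>2 / 8) + (exp (l * (a + d)) - exp (l * a)) / d * y"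
proof (cases "d = 0")
  case True
  then show ?thesis
    using assms by simp
next
  case False
  then have "0 < d"
    using d by simp
  \<comment> \<open>\<open>p\<close> is the relative position of 0 in \<open>[a, a + d]\<close>:
    mass \<open>p\<close> at \<open>a + d\<close> and \<open>1 - p\<close> at \<open>a\<close> is
    the centred two-point law, and the chord at 0 is its exponential moment.\<close>
  define p where "p = - a / d"
  have p: "0 \<le> p" "p \<le> 1"
    using a \<open>0 < d\<close> by (auto simp: p_def divide_simps)
  have ap: "a = - p * d"
    using \<open>0 < d\<close> by (simp add: p_def)
  define t where "t = (y - a) / d"
  have t: "0 \<le> t" "t \<le> 1"
    using y \<open>0 < d\<close> by (auto simp: t_def divide_simps)
  have yt: "y = a + t * d"
    using \<open>0 < d\<close> by (simp add: t_def)
  have "exp (l * ((1 - t) *\<^sub>R a + t *\<^sub>R (a + d))) \<le> (1 - t) * exp (l * a) + t * exp (l * (a + d))"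
    using t l by (intro convex_onD[OF convex_on_exp]) auto
  also have "(1 - t) *\<^sub>R a + t *\<^sub>R (a + d) = y"
    by (simp add: yt algebra_simps)
  also have "(1 - t) * exp (l * a) + t * exp (l * (a + d)) =
      (1 - p) * exp (l * a) + p * exp (l * (a + d)) + (exp (l * (a + d)) - exp (l * a)) / d * y"
    using \<open>0 < d\<close> by (simp add: yt ap field_simps)
  also have "(1 - p) * exp (l * a) + p * exp (l * (a + d)) \<le> exp (l\<^sup>2 * d\<^sup>2 / 8)"
  proof -
    have h: "0 \<le> l * d"
      using l d by simp
    have pos: "0 < 1 + p * (exp (l * d) - 1)"
      using p h by (intro add_pos_nonneg mult_nonneg_nonneg) auto
    have "(1 - p) * exp (l * a) + p * exp (l * (a + d)) = exp (- (l * d) * p) * (1 + p * (exp (l * d) - 1))"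
      by (simp add: ap algebra_simps exp_add exp_diff exp_minus divide_inverse)
    also have "\<dots> = exp (- (l * d) * p + ln (1 + p * (exp (l * d) - 1)))"
      by (simp only: exp_add exp_ln[OF pos])
    also have "\<dots> \<le> exp ((l * d)\<^sup>2 / 8)"
      using Hoeffdings_lemma_aux[OF h p(1)] by simp
    finally show ?thesis
      by (simp add: power_mult_distrib)
  qed
  finally show ?thesis
    by simp
qed

text \<open>\<open>exp_le_chord\<close> is used pointwise with \<open>y = D' - D\<close> and left
  endpoint \<open>L - D\<close>. The linear term is then \<open>w * (D' - D)\<close> with
  \<open>w\<close> measurable for \<open>F\<close>, and its integral vanishes because
  \<open>D\<close> is the conditional expectation of \<open>D'\<close>. The exponential itself is
  never conditioned.\<close>

lemma (in prob_space) conditional_Hoeffding: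
  assumes F: "subalgebra M F" and D [measurable]: "D \<in> borel_measurable F" and L [measurable]: "L \<in> borel_measurable F"
    and D': "D' \<in> borel_measurable M" and B: "AE \<omega> in M. \<bar>D' \<omega>\<bar> \<le> B"
    and ce: "AE \<omega> in M. real_cond_exp M F D' \<omega> = D \<omega>"
    and LD': "AE \<omega> in M. L \<omega> \<le> D' \<omega> \<and> D' \<omega> \<le> L \<omega> + d"
    and l: "0 \<le> l" and d: "0 \<le> d"
  shows "(\<integral>\<omega>. exp (l * D' \<omega>) \<partial>M) \<le> exp (l\<^sup>2 * d\<^sup>2 / 8) * (\<integral>\<omega>. exp (l * D \<omega>) \<partial>M)"
proof -
  interpret S: sigma_finite_subalgebra M F
    using F by (rule sigma_finite_subalgebraI)
  note [measurable] = measurable_from_subalg[OF F D] measurable_from_subalg[OF F L] D'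
  have intD': "integrable M D'"
    using B by (intro integrable_const_bound[where B = B]) auto
  \<comment> \<open>Conditioning \<open>L \<le> D' \<le> L + d\<close> on \<open>F\<close> leaves
    the endpoints unchanged and turns \<open>D'\<close> into \<open>D\<close>. This places 0 in
    \<open>[L - D, L - D + d]\<close>, as the chord bound requires.\<close>
  have bnd: "AE \<omega> in M. L \<omega> \<le> D \<omega> \<and> D \<omega> \<le> L \<omega> + d \<and> \<bar>D \<omega>\<bar> \<le> B"
  proof -
    have "AE \<omega> in M. \<bar>L \<omega>\<bar> \<le> B + d"
      using LD' B by eventually_elim linarith
    then have intL: "integrable M L"
      by (intro integrable_const_bound[where B = "B + d"]) auto
    have intLd: "integrable M (\<lambda>\<omega>. L \<omega> + d)"
      using intL by simp
    have ae: "AE \<omega> in M. L \<omega> \<le> D' \<omega>" "AE \<omega> in M. D' \<omega> \<le> L \<omega> + d"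
      "AE \<omega> in M. D' \<omega> \<ge> - B" "AE \<omega> in M. D' \<omega> \<le> B"
      using LD' B by (eventually_elim, linarith)+
    note S.real_cond_exp_mono[OF ae(1) intL intD'] S.real_cond_exp_mono[OF ae(2) intD' intLd]
      S.real_cond_exp_ge_c[OF intD' ae(3)] S.real_cond_exp_le_c[OF intD' ae(4)]
    moreover have "AE \<omega> in M. real_cond_exp M F L \<omega> = L \<omega>"
      using intL by (intro S.real_cond_exp_F_meas) auto
    moreover have "AE \<omega> in M. real_cond_exp M F (\<lambda>\<omega>. L \<omega> + d) \<omega> = L \<omega> + d"
      using intL by (intro S.real_cond_exp_F_meas) auto
    ultimately show ?thesis
      using ce by eventually_elim auto
  qed
  define w where "w \<omega> = exp (l * D \<omega>) * ((exp (l * (L \<omega> - D \<omega> + d)) - exp (l * (L \<omega> - D \<omega>))) / d)" for \<omega>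
  have w [measurable]: "w \<in> borel_measurable F"
    unfolding w_def by measurable
  note [measurable] = measurable_from_subalg[OF F w]
  have wB: "AE \<omega> in M. \<bar>w \<omega>\<bar> \<le> exp (l * B) * (exp (l * d) / d)"
    using bnd
  proof eventually_elim
    case (elim \<omega>)
    have 1: "exp (l * D \<omega>) \<le> exp (l * B)"
      using elim l by (auto intro!: mult_left_mono)
    have 2: "exp (l * (L \<omega> - D \<omega> + d)) \<le> exp (l * d)"
      using elim l by (auto intro!: mult_left_mono)
    have 3: "exp (l * (L \<omega> - D \<omega>)) \<le> exp (l * (L \<omega> - D \<omega> + d))"
      using l d by (auto intro!: mult_left_mono)
    have "\<bar>exp (l * (L \<omega> - D \<omega> + d)) - exp (l * (L \<omega> - D \<omega>))\<bar> \<le> exp (l * d)"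
      using 2 3 exp_ge_zero[of "l * (L \<omega> - D \<omega>)"] by linarith
    then show ?case
      unfolding w_def abs_mult using 1 d by (intro mult_mono) (auto intro: divide_right_mono)
  qed
  have DB: "AE \<omega> in M. exp (l * D \<omega>) \<le> exp (l * B)"
    using bnd by eventually_elim (use l in \<open>auto intro!: mult_left_mono\<close>)
  have D'B: "AE \<omega> in M. exp (l * D' \<omega>) \<le> exp (l * B)"
    using B by eventually_elim (use l in \<open>auto intro!: mult_left_mono\<close>)
  have int1: "integrable M (\<lambda>\<omega>. exp (l * D \<omega>))" "integrable M (\<lambda>\<omega>. exp (l * D' \<omega>))"
    using DB D'B by (auto intro!: integrable_const_bound[where B = "exp (l * B)"])
  have prod_bound: "AE \<omega> in M. norm (w \<omega> * k \<omega>) \<le> exp (l * B) * (exp (l * d) / d) * B"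
    if "AE \<omega> in M. \<bar>k \<omega>\<bar> \<le> B" for k
    using wB that by eventually_elim (unfold real_norm_def abs_mult, rule mult_mono, auto simp: d)
  have bD: "AE \<omega> in M. \<bar>D \<omega>\<bar> \<le> B"
    using bnd by eventually_elim auto
  have int2: "integrable M (\<lambda>\<omega>. w \<omega> * D \<omega>)" "integrable M (\<lambda>\<omega>. w \<omega> * D' \<omega>)"
    using prod_bound[OF bD] prod_bound[OF B] by (auto intro!: integrable_const_bound)
  have "(\<integral>\<omega>. w \<omega> * D' \<omega> \<partial>M) = (\<integral>\<omega>. w \<omega> * real_cond_exp M F D' \<omega> \<partial>M)"
    by (rule S.real_cond_exp_intg(2)[symmetric]) (use int2 in auto)
  also have "\<dots> = (\<integral>\<omega>. w \<omega> * D \<omega> \<partial>M)"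
    using ce by (intro integral_cong_AE) auto
  finally have eq: "(\<integral>\<omega>. w \<omega> * D' \<omega> \<partial>M) = (\<integral>\<omega>. w \<omega> * D \<omega> \<partial>M)" .
  let ?K = "exp (l\<^sup>2 * d\<^sup>2 / 8)"
  have "(\<integral>\<omega>. exp (l * D' \<omega>) \<partial>M) \<le> (\<integral>\<omega>. ?K * exp (l * D \<omega>) + (w \<omega> * D' \<omega> - w \<omega> * D \<omega>) \<partial>M)"
  proof (rule integral_mono_AE)
    show "AE \<omega> in M. exp (l * D' \<omega>) \<le> ?K * exp (l * D \<omega>) + (w \<omega> * D' \<omega> - w \<omega> * D \<omega>)"
      using bnd LD'
    proof eventually_elim
      case (elim \<omega>)
      have "exp (l * D' \<omega>) = exp (l * D \<omega>) * exp (l * (D' \<omega> - D \<omega>))"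
        by (simp add: exp_add[symmetric] algebra_simps)
      also have "\<dots> \<le> exp (l * D \<omega>) * (?K +
          (exp (l * (L \<omega> - D \<omega> + d)) - exp (l * (L \<omega> - D \<omega>))) / d * (D' \<omega> - D \<omega>))"
        using elim l d by (intro mult_left_mono exp_le_chord) auto
      also have "\<dots> = ?K * exp (l * D \<omega>) + (w \<omega> * D' \<omega> - w \<omega> * D \<omega>)"
      proof -
        have "e * (k + s * (x - y)) = k * e + (e * s * x - e * s * y)" for e k s x y :: real
          by (simp add: algebra_simps)
        then show ?thesis
          unfolding w_def .
      qed
      finally show ?case .
    qed
  qed (use int1 int2 in auto)
  also have "\<dots> = ?K * (\<integral>\<omega>. exp (l * D \<omega>) \<partial>M)"
    using int1 int2 eq by simp
  finally show ?thesis .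
qed

section \<open>The Doob martingale of a forest-dependent vector\<close>

text \<open>The rooted forest is given by the root set \<open>R\<close>, the parent map and a
  \<open>rank\<close> that rules out cycles; its edges are the pairs \<open>{v, par v}\<close> with
  \<open>v \<in> V - R\<close>. Thus \<open>dep\<close> is graph dependence, with non-adjacency
  checked along parent links in both directions.\<close>

locale forest_dependent = prob_space M for M :: "'w measure" +
  fixes V :: "'i set" and \<Omega> :: "'i \<Rightarrow> 'a topology" and c :: "'i \<Rightarrow> real"
    and f :: "('i \<Rightarrow> 'a) \<Rightarrow> real" and X :: "'w \<Rightarrow> 'i \<Rightarrow> 'a"
    and R :: "'i set" and par :: "'i \<Rightarrow> 'i" and rank :: "'i \<Rightarrow> nat"
    and N :: "'i \<Rightarrow> 'a measure"
  defines N_def: "N \<equiv> \<lambda>i. borel_of_topology (\<Omega> i)"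
  assumes V: "finite V"
    and pol: "\<And>i. i \<in> V \<Longrightarrow> polish_topology (\<Omega> i)"
    and c: "\<And>i. i \<in> V \<Longrightarrow> 0 \<le> c i"
    and f [measurable]: "f \<in> borel_measurable (Pi\<^sub>M V N)"
    and lip: "lipschitz_wrt V (\<lambda>i. topspace (\<Omega> i)) c f"
    and X [measurable]: "X \<in> measurable M (Pi\<^sub>M V N)"
    and par: "\<And>v. v \<in> V - R \<Longrightarrow> par v \<in> V \<and> rank (par v) < rank v"
    and dep: "\<And>S T. S \<subseteq> V \<Longrightarrow> T \<subseteq> V \<Longrightarrow> S \<inter> T = {} \<Longrightarrow>
      (\<And>v. v \<in> V - R \<Longrightarrow> \<not> (v \<in> S \<and> par v \<in> T) \<and> \<not> (v \<in> T \<and> par v \<in> S)) \<Longrightarrow>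
      indep_var (Pi\<^sub>M S N) (\<lambda>\<omega>. restrict (X \<omega>) S) (Pi\<^sub>M T N) (\<lambda>\<omega>. restrict (X \<omega>) T)"
begin

definition sig :: "'i set \<Rightarrow> 'w measure" where
  "sig S = vimage_algebra (space M) (\<lambda>\<omega>. restrict (X \<omega>) S) (Pi\<^sub>M S N)"

text \<open>The index is the set of coordinates that are still unrevealed.\<close>

definition mart :: "'i set \<Rightarrow> 'w \<Rightarrow> real" where
  "mart S = real_cond_exp M (sig (V - S)) (\<lambda>\<omega>. f (X \<omega>))"

definition weight :: "'i \<Rightarrow> real" where
  "weight v = (if v \<in> R then c v else c v + c (par v))"

text \<open>These ancestor-closed sets are exactly the sets of unrevealed coordinates that can arise
  when children precede parents.\<close>

definition par_closed :: "'i set \<Rightarrow> bool" where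
  "par_closed S \<longleftrightarrow> S \<subseteq> V \<and> (\<forall>v\<in>S - R. par v \<in> S)"

lemma space_sig [simp]: "space (sig S) = space M"
  by (simp add: sig_def)

lemma restrict_measurable_M: "S \<subseteq> V \<Longrightarrow> (\<lambda>\<omega>. restrict (X \<omega>) S) \<in> measurable M (Pi\<^sub>M S N)"
  by (rule measurable_compose[OF X measurable_restrict_subset])

lemma restrict_measurable_self: "S \<subseteq> V \<Longrightarrow> (\<lambda>\<omega>. restrict (X \<omega>) S) \<in> measurable (sig S) (Pi\<^sub>M S N)"
  unfolding sig_def using restrict_measurable_M[of S]
  by (intro measurable_vimage_algebra1) (auto simp: measurable_def)

lemma restrict_measurable:
  assumes "S \<subseteq> S'" "S' \<subseteq> V"
  shows "(\<lambda>\<omega>. restrict (X \<omega>) S) \<in> measurable (sig S') (Pi\<^sub>M S N)"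
proof -
  have "(\<lambda>\<omega>. restrict (restrict (X \<omega>) S') S) \<in> measurable (sig S') (Pi\<^sub>M S N)"
    by (rule measurable_compose[OF restrict_measurable_self[OF assms(2)] measurable_restrict_subset[OF assms(1)]])
  then show ?thesis
    using assms(1) by (simp add: Int_absorb1)
qed

lemma sets_sig: "S \<subseteq> V \<Longrightarrow> sets (sig S) = {{\<omega>\<in>space M. restrict (X \<omega>) S \<in> A} | A. A \<in> sets (Pi\<^sub>M S N)}"
  unfolding sig_def using restrict_measurable_M[of S]
  by (subst sets_vimage_algebra2) (auto simp: measurable_def vimage_def)

lemma sig_subalgebra: "S \<subseteq> V \<Longrightarrow> subalgebra M (sig S)"
  using restrict_measurable_M[of S] measurable_sets[OF restrict_measurable_M[of S]]
  by (auto simp: subalgebra_def sets_sig vimage_def Int_def conj_commute)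

lemma sig_mono:
  assumes "S \<subseteq> S'" "S' \<subseteq> V"
  shows "subalgebra (sig S') (sig S)"
proof -
  have "S \<subseteq> V"
    using assms by simp
  then show ?thesis
    using measurable_sets[OF restrict_measurable[OF assms]]
    by (auto simp: subalgebra_def sets_sig[OF \<open>S \<subseteq> V\<close>] vimage_def Int_def conj_commute)
qed

lemma space_Pi_N: "space (Pi\<^sub>M V N) = Pi\<^sub>E V (\<lambda>i. topspace (\<Omega> i))"
  by (simp add: space_PiM N_def)

text \<open>Replacing every coordinate costs at most the sum of the \<open>c i\<close>; the base
  point is a value of \<open>X\<close>, whose probability space is nonempty.\<close>

lemma f_bounded: "\<exists>B\<ge>0. \<forall>x\<in>space (Pi\<^sub>M V N). \<bar>f x\<bar> \<le> B"
proof -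
  obtain x0 where x0: "x0 \<in> space (Pi\<^sub>M V N)"
    using not_empty measurable_space[OF X] by blast
  have "\<bar>f x\<bar> \<le> \<bar>f x0\<bar> + (\<Sum>i\<in>V. c i)" if "x \<in> space (Pi\<^sub>M V N)" for x
  proof -
    have "\<bar>f x - f x0\<bar> \<le> (\<Sum>i\<in>V. c i * of_bool (x i \<noteq> x0 i))"
      using lip that x0 unfolding lipschitz_wrt_def space_Pi_N by blast
    also have "\<dots> \<le> (\<Sum>i\<in>V. c i)"
      using c by (intro sum_mono) auto
    finally show ?thesis
      by linarith
  qed
  then show ?thesis
    using c by (intro exI[of _ "\<bar>f x0\<bar> + (\<Sum>i\<in>V. c i)"]) (auto intro!: add_nonneg_nonneg sum_nonneg)
qed

lemma weight_nonneg: "v \<in> V \<Longrightarrow> 0 \<le> weight v"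
  using c par by (auto simp: weight_def)

lemma fX_measurable [measurable]: "(\<lambda>\<omega>. f (X \<omega>)) \<in> borel_measurable M"
  by measurable

lemma fX_integrable: "integrable M (\<lambda>\<omega>. f (X \<omega>))"
proof -
  obtain B where "\<forall>x\<in>space (Pi\<^sub>M V N). \<bar>f x\<bar> \<le> B"
    using f_bounded by blast
  then show ?thesis
    using measurable_space[OF X] by (intro integrable_const_bound[where B = B]) (auto intro!: AE_I2)
qed

lemma mart_measurable: "mart S \<in> borel_measurable (sig (V - S))"
  by (simp add: mart_def)

lemma mart_nested:
  assumes "S' \<subseteq> S"
  shows "AE \<omega> in M. real_cond_exp M (sig (V - S)) (mart S') \<omega> = mart S \<omega>"
proof -
  interpret S: sigma_finite_subalgebra M "sig (V - S)"
    by (intro sigma_finite_subalgebraI sig_subalgebra) auto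
  show ?thesis
    unfolding mart_def using assms
    by (intro S.real_cond_exp_nested_subalg sig_subalgebra sig_mono fX_integrable) auto
qed

lemma mart_empty: "AE \<omega> in M. mart {} \<omega> = f (X \<omega>)"
proof -
  interpret S: sigma_finite_subalgebra M "sig V"
    by (intro sigma_finite_subalgebraI sig_subalgebra) auto
  have r: "restrict (X \<omega>) V = X \<omega>" if "\<omega> \<in> space M" for \<omega>
    using measurable_space[OF X that] by (auto simp: space_PiM)
  have "(\<lambda>\<omega>. f (restrict (X \<omega>) V)) \<in> borel_measurable (sig V)"
    by (rule measurable_compose[OF restrict_measurable f]) auto
  then have "(\<lambda>\<omega>. f (X \<omega>)) \<in> borel_measurable (sig V)"
    by (subst measurable_cong[where g = "\<lambda>\<omega>. f (restrict (X \<omega>) V)"]) (simp_all add: r)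
  then show ?thesis
    unfolding mart_def using fX_integrable by (auto intro!: S.real_cond_exp_F_meas)
qed

lemma mart_V: "AE \<omega> in M. mart V \<omega> = expectation (\<lambda>\<omega>. f (X \<omega>))"
proof -
  interpret S: sigma_finite_subalgebra M "sig (V - V)"
    by (intro sigma_finite_subalgebraI sig_subalgebra) auto
  show ?thesis
    unfolding mart_def
  proof (rule S.real_cond_exp_charact)
    fix A assume "A \<in> sets (sig (V - V))"
    \<comment> \<open>Restriction to the empty set is the constant function
      \<open>undefined\<close>, so nothing is revealed and the sigma-algebra is trivial.\<close>
    then have "A = {} \<or> A = space M"
      by (auto simp: sets_sig restrict_def)
    then show "(\<integral>\<omega>\<in>A. f (X \<omega>) \<partial>M) = (\<integral>\<omega>\<in>A. expectation (\<lambda>\<omega>. f (X \<omega>)) \<partial>M)"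
    proof
      assume "A = {}"
      then show ?thesis
        by (simp add: set_lebesgue_integral_def)
    next
      assume "A = space M"
      then show ?thesis
        using fX_integrable by (simp add: set_integral_space prob_space)
    qed
  qed (auto simp: fX_integrable)
qed

lemma mart_bounded:
  assumes B: "\<forall>x\<in>space (Pi\<^sub>M V N). \<bar>f x\<bar> \<le> B"
  shows "AE \<omega> in M. \<bar>mart S \<omega>\<bar> \<le> B"
proof -
  interpret S: sigma_finite_subalgebra M "sig (V - S)"
    by (intro sigma_finite_subalgebraI sig_subalgebra) auto
  have "\<bar>f (X \<omega>)\<bar> \<le> B" if "\<omega> \<in> space M" for \<omega>
    using B measurable_space[OF X that] by auto
  then have "AE \<omega> in M. f (X \<omega>) \<le> B" "AE \<omega> in M. f (X \<omega>) \<ge> - B"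
    by (intro AE_I2; fastforce simp: abs_le_iff)+
  note S.real_cond_exp_le_c[OF fX_integrable this(1)] S.real_cond_exp_ge_c[OF fX_integrable this(2)]
  then show ?thesis
    unfolding mart_def by eventually_elim auto
qed

section \<open>The range of one martingale step\<close>

definition step :: "'i rel" where
  "step = {(u, par u) | u. u \<in> V - R}"

definition descendants :: "'i \<Rightarrow> 'i set" where
  "descendants v = {u. (u, v) \<in> step\<^sup>*}"

lemma descendants_refl [simp]: "v \<in> descendants v"
  by (simp add: descendants_def)

lemma descendants_subset: "v \<in> V \<Longrightarrow> descendants v \<subseteq> V"
  by (auto simp: descendants_def step_def elim: converse_rtranclE)

lemma par_in_descendants:
  assumes "u \<in> V - R"
  shows "par u \<in> descendants v \<Longrightarrow> u \<in> descendants v"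
    and "u \<in> descendants v \<Longrightarrow> u \<noteq> v \<Longrightarrow> par u \<in> descendants v"
proof -
  have "(u, par u) \<in> step"
    using assms by (auto simp: step_def)
  then show "par u \<in> descendants v \<Longrightarrow> u \<in> descendants v"
    by (auto simp: descendants_def intro: converse_rtrancl_into_rtrancl)
  show "u \<in> descendants v \<Longrightarrow> u \<noteq> v \<Longrightarrow> par u \<in> descendants v"
    unfolding descendants_def mem_Collect_eq by (erule converse_rtranclE) (auto simp: step_def)
qed

lemma par_closed_descendant:
  assumes "par_closed S" "u \<in> S" "u \<in> descendants v"
  shows "v \<in> S"
proof -
  have "(u, v) \<in> step\<^sup>*"
    using assms by (simp add: descendants_def)
  then show ?thesis
    using assms(2)
  proof (induction rule: converse_rtrancl_induct)
    case (step x y)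
    then show ?case
      using assms(1) by (auto simp: step_def par_closed_def)
  qed
qed

text \<open>The independent blocks are \<open>C\<close> (the subtree of \<open>v\<close>) and
  \<open>T\<close> (everything outside \<open>C\<close> and \<open>Z\<close>), and \<open>Q\<close>
  is the revealed part of \<open>T\<close>. After the step \<open>C \<union> Q\<close> is known,
  before it \<open>(C - {v}) \<union> Q\<close>, while \<open>g\<close> reads
  \<open>(C - {v}) \<union> T\<close>. So \<open>real_cond_exp_reduce\<close> applies with
  \<open>p\<close> forgetting \<open>v\<close> and \<open>q\<close> restricting to \<open>Q\<close>,
  and \<open>L\<close> is the resulting earlier-measurable version of the conditional expectation of
  \<open>g\<close>.\<close>

lemma mart_range:
  assumes S: "par_closed S" "par_closed (S - {v})" and v: "v \<in> S"
  obtains L where "L \<in> borel_measurable (sig (V - S))"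
    "AE \<omega> in M. L \<omega> \<le> mart (S - {v}) \<omega> \<and> mart (S - {v}) \<omega> \<le> L \<omega> + weight v"
proof -
  obtain B where B: "0 \<le> B" "\<And>x. x \<in> space (Pi\<^sub>M V N) \<Longrightarrow> \<bar>f x\<bar> \<le> B"
    using f_bounded by blast
  have SV: "S \<subseteq> V"
    using S by (simp add: par_closed_def)
  then have vV: "v \<in> V"
    using v by auto
  define Z where "Z = (if v \<in> R then {v} else {v, par v})"
  have pv: "par v \<in> S - {v}" if "v \<notin> R"
    using that S(1) v vV par[of v] by (auto simp: par_closed_def)
  have ZV: "Z \<subseteq> V"
    using vV pv SV by (auto simp: Z_def)
  have Zc: "(\<Sum>i\<in>Z. c i) = weight v"
    using pv by (auto simp: Z_def weight_def)
  obtain g where g: "g \<in> borel_measurable (Pi\<^sub>M (V - Z) N)" "\<And>y. \<bar>g y\<bar> \<le> \<bar>B\<bar>"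
    "AE \<omega> in M. g (restrict (X \<omega>) (V - Z)) \<le> f (X \<omega>) \<and>
       f (X \<omega>) \<le> g (restrict (X \<omega>) (V - Z)) + (\<Sum>i\<in>Z. c i)"
    by (rule lipschitz_sandwich[OF finite_measure_axioms V ZV pol X[unfolded N_def] f[unfolded N_def] lip c
          B(2)[unfolded N_def], folded N_def]) (assumption | rule that)+
  define C where "C = descendants v"
  define T where "T = V - C - Z"
  define Q where "Q = V - S - C"
  have CV: "C \<subseteq> V"
    using descendants_subset[OF vV] by (simp add: C_def)
  have vC: "v \<in> C"
    by (simp add: C_def)
  \<comment> \<open>A proper descendant of \<open>v\<close> that is still unrevealed would, by
    ancestor-closure, force \<open>v\<close> into \<open>S - {v}\<close>.\<close>
  have CS: "C \<inter> (S - {v}) = {}"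
  proof -
    have False if "u \<in> C" "u \<in> S - {v}" for u
      using par_closed_descendant[OF S(2) that(2), of v] that(1) by (simp add: C_def)
    then show ?thesis
      by blast
  qed
  have QT: "Q \<subseteq> T"
    using v pv by (auto simp: Q_def T_def Z_def)
  have un: "(C - {v}) \<union> T = V - Z" "C \<union> Q = V - (S - {v})"
  proof -
    have "Z \<inter> C = {v}"
      using vC CS pv by (cases "v \<in> R") (auto simp: Z_def)
    then show "(C - {v}) \<union> T = V - Z"
      using CV unfolding T_def by blast
    show "C \<union> Q = V - (S - {v})"
      using CV vC CS unfolding Q_def by blast
  qed
  have indep: "indep_var (Pi\<^sub>M C N) (\<lambda>\<omega>. restrict (X \<omega>) C) (Pi\<^sub>M T N) (\<lambda>\<omega>. restrict (X \<omega>) T)"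
  proof (rule dep)
    fix u assume u: "u \<in> V - R"
    \<comment> \<open>The only parent link that leaves \<open>C\<close> starts at \<open>v\<close>,
      and its endpoint was put into \<open>Z\<close>.\<close>
    have "par u \<notin> T" if "u \<in> C"
    proof (cases "u = v")
      case True
      then show ?thesis
        using u by (auto simp: T_def Z_def)
    next
      case False
      then show ?thesis
        using par_in_descendants(2)[OF u, of v] that by (auto simp: C_def T_def)
    qed
    moreover have "u \<notin> T" if "par u \<in> C"
      using par_in_descendants(1)[OF u, of v] that by (auto simp: C_def T_def)
    ultimately show "\<not> (u \<in> C \<and> par u \<in> T) \<and> \<not> (u \<in> T \<and> par u \<in> C)"
      by blast
  qed (use CV in \<open>auto simp: T_def\<close>)
  let ?p = "\<lambda>x. restrict x (C - {v})" and ?q = "\<lambda>x. restrict x Q"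
  have p: "?p \<in> measurable (Pi\<^sub>M C N) (Pi\<^sub>M (C - {v}) N)"
    by (rule measurable_restrict_subset) auto
  have q: "?q \<in> measurable (Pi\<^sub>M T N) (Pi\<^sub>M Q N)"
    using QT by (rule measurable_restrict_subset)
  have rp: "?p (restrict (X \<omega>) C) = restrict (X \<omega>) (C - {v})" for \<omega>
    by (simp add: Int_absorb1 Diff_subset)
  have rq: "?q (restrict (X \<omega>) T) = restrict (X \<omega>) Q" for \<omega>
    using QT by (simp add: Int_absorb1)
  define g' where "g' z = g (merge (C - {v}) T z)" for z
  have g'm: "g' \<in> borel_measurable (Pi\<^sub>M (C - {v}) N \<Otimes>\<^sub>M Pi\<^sub>M T N)"
    unfolding g'_def using g(1) by (intro measurable_compose[OF measurable_merge]) (simp add: un)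
  have g'B: "\<bar>g' z\<bar> \<le> \<bar>B\<bar>" for z
    using g(2) by (simp add: g'_def)
  have mrg: "merge A A' (restrict x A, restrict x A') = restrict x (A \<union> A')" for A A' and x :: "'i \<Rightarrow> 'a"
    by (auto simp: merge_def fun_eq_iff)
  have g'X: "g' (?p (restrict (X \<omega>) C), restrict (X \<omega>) T) = g (restrict (X \<omega>) (V - Z))" for \<omega>
    unfolding g'_def rp mrg un ..
  let ?F = "sig (V - (S - {v}))" and ?F' = "sig (V - S)"
  obtain L where L: "L \<in> borel_measurable ?F'"
    "AE \<omega> in M. real_cond_exp M ?F (\<lambda>\<omega>. g' (?p (restrict (X \<omega>) C), restrict (X \<omega>) T)) \<omega> = L \<omega>"
  proof (rule real_cond_exp_reduce[OF indep p q g'm g'B])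
    show "subalgebra M ?F"
      by (rule sig_subalgebra) auto
    show "subalgebra ?F ?F'"
      by (rule sig_mono) auto
    show "(\<lambda>\<omega>. (?p (restrict (X \<omega>) C), ?q (restrict (X \<omega>) T))) \<in> measurable ?F' (Pi\<^sub>M (C - {v}) N \<Otimes>\<^sub>M Pi\<^sub>M Q N)"
      unfolding rp rq using CS CV by (intro measurable_Pair restrict_measurable) (auto simp: Q_def)
    fix A assume "A \<in> sets ?F"
    then obtain A0 where A0: "A0 \<in> sets (Pi\<^sub>M (C \<union> Q) N)" "A = {\<omega>\<in>space M. restrict (X \<omega>) (C \<union> Q) \<in> A0}"
      using sets_sig[of "V - (S - {v})"] unfolding un by auto
    let ?A' = "merge C Q -` A0 \<inter> space (Pi\<^sub>M C N \<Otimes>\<^sub>M Pi\<^sub>M Q N)"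
    have "?A' \<in> sets (Pi\<^sub>M C N \<Otimes>\<^sub>M Pi\<^sub>M Q N)"
      by (rule measurable_sets[OF measurable_merge A0(1)])
    moreover have "(restrict (X \<omega>) C, restrict (X \<omega>) Q) \<in> space (Pi\<^sub>M C N \<Otimes>\<^sub>M Pi\<^sub>M Q N)" if "\<omega> \<in> space M" for \<omega>
      using that measurable_space[OF restrict_measurable_M[OF CV]] measurable_space[OF restrict_measurable_M[of Q]]
      by (auto simp: space_pair_measure Q_def)
    then have "A = {\<omega>\<in>space M. (restrict (X \<omega>) C, ?q (restrict (X \<omega>) T)) \<in> ?A'}"
      unfolding A0(2) rq by (auto simp only: mrg vimage_eq Int_iff mem_Collect_eq)
    ultimately show "\<exists>A'\<in>sets (Pi\<^sub>M C N \<Otimes>\<^sub>M Pi\<^sub>M Q N).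
        A = {\<omega>\<in>space M. (restrict (X \<omega>) C, ?q (restrict (X \<omega>) T)) \<in> A'}"
      by blast
  qed (rule that)
  interpret F: sigma_finite_subalgebra M ?F
    by (intro sigma_finite_subalgebraI sig_subalgebra) auto
  let ?g = "\<lambda>\<omega>. g (restrict (X \<omega>) (V - Z))"
  have "?g \<in> borel_measurable M"
    by (rule measurable_compose[OF restrict_measurable_M g(1)]) auto
  then have intg: "integrable M ?g"
    using g(2) by (intro integrable_const_bound[where B = "\<bar>B\<bar>"]) auto
  then have intg': "integrable M (\<lambda>\<omega>. ?g \<omega> + weight v)"
    by simp
  have ae: "AE \<omega> in M. ?g \<omega> \<le> f (X \<omega>)" "AE \<omega> in M. f (X \<omega>) \<le> ?g \<omega> + weight v"
    using g(3) unfolding Zc by (eventually_elim, simp)+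
  have "AE \<omega> in M. real_cond_exp M ?F (\<lambda>\<omega>. ?g \<omega> + weight v) \<omega> =
      real_cond_exp M ?F ?g \<omega> + real_cond_exp M ?F (\<lambda>_. weight v) \<omega>"
    using intg by (intro F.real_cond_exp_add) auto
  moreover have "AE \<omega> in M. real_cond_exp M ?F (\<lambda>_. weight v) \<omega> = weight v"
    by (intro F.real_cond_exp_F_meas) auto
  moreover note F.real_cond_exp_mono[OF ae(1) intg fX_integrable] F.real_cond_exp_mono[OF ae(2) fX_integrable intg']
  moreover have "AE \<omega> in M. real_cond_exp M ?F ?g \<omega> = L \<omega>"
    using L(2) unfolding g'X .
  ultimately have "AE \<omega> in M. L \<omega> \<le> mart (S - {v}) \<omega> \<and> mart (S - {v}) \<omega> \<le> L \<omega> + weight v"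
    unfolding mart_def by eventually_elim auto
  with L(1) show ?thesis
    by (rule that)
qed

section \<open>Exponential moments and the tail bound\<close>

lemma exp_moment_step:
  assumes "par_closed S" "par_closed (S - {v})" "v \<in> S" "0 \<le> l"
  shows "(\<integral>\<omega>. exp (l * mart (S - {v}) \<omega>) \<partial>M) \<le>
    exp (l\<^sup>2 * (weight v)\<^sup>2 / 8) * (\<integral>\<omega>. exp (l * mart S \<omega>) \<partial>M)"
proof -
  obtain B where B: "\<forall>x\<in>space (Pi\<^sub>M V N). \<bar>f x\<bar> \<le> B"
    using f_bounded by blast
  obtain L where L: "L \<in> borel_measurable (sig (V - S))"
    "AE \<omega> in M. L \<omega> \<le> mart (S - {v}) \<omega> \<and> mart (S - {v}) \<omega> \<le> L \<omega> + weight v"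
    using mart_range[OF assms(1-3)] .
  show ?thesis
  proof (rule conditional_Hoeffding[OF _ mart_measurable L(1) _ mart_bounded[OF B] mart_nested L(2) assms(4)])
    show "subalgebra M (sig (V - S))"
      by (rule sig_subalgebra) auto
    show "mart (S - {v}) \<in> borel_measurable M"
      by (simp add: mart_def)
    show "0 \<le> weight v"
      using assms by (intro weight_nonneg) (auto simp: par_closed_def)
  qed auto
qed

text \<open>A vertex of maximal rank in \<open>S\<close> is nobody's parent within \<open>S\<close>,
  so removing it leaves an ancestor-closed set. The induction on \<open>card S\<close> thus walks
  back along a children-first order, each step costing the factor of one weight.\<close>

lemma exp_moment_par_closed:
  assumes "0 \<le> l" "par_closed S"
  shows "(\<integral>\<omega>. exp (l * f (X \<omega>)) \<partial>M) \<le>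
    exp (l\<^sup>2 * (\<Sum>v\<in>S. (weight v)\<^sup>2) / 8) * (\<integral>\<omega>. exp (l * mart S \<omega>) \<partial>M)"
  using assms(2)
proof (induction "card S" arbitrary: S)
  case 0
  then have "S = {}"
    using V by (auto simp: par_closed_def dest: finite_subset)
  moreover have "(\<integral>\<omega>. exp (l * f (X \<omega>)) \<partial>M) = (\<integral>\<omega>. exp (l * mart {} \<omega>) \<partial>M)"
  proof (rule integral_cong_AE)
    show "AE \<omega> in M. exp (l * f (X \<omega>)) = exp (l * mart {} \<omega>)"
      using mart_empty by eventually_elim simp
  qed (simp_all add: mart_def)
  ultimately show ?case
    by simp
next
  case (Suc n)
  have fin: "finite S" and SV: "S \<subseteq> V"
    using Suc.prems V by (auto simp: par_closed_def dest: finite_subset)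
  then have "S \<noteq> {}"
    using Suc.hyps by auto
  then have "Max (rank ` S) \<in> rank ` S"
    using fin by (intro Max_in) auto
  then obtain v where v: "v \<in> S" and "rank v = Max (rank ` S)"
    by auto
  then have max: "rank u \<le> rank v" if "u \<in> S" for u
    using that fin by simp
  have "par u \<noteq> v" if "u \<in> S - R" for u
    using par[of u] max[of u] that SV by fastforce
  then have pc: "par_closed (S - {v})"
    using Suc.prems by (auto simp: par_closed_def)
  have "n = card (S - {v})"
    using Suc.hyps v fin by simp
  then have "(\<integral>\<omega>. exp (l * f (X \<omega>)) \<partial>M) \<le>
      exp (l\<^sup>2 * (\<Sum>v\<in>S - {v}. (weight v)\<^sup>2) / 8) * (\<integral>\<omega>. exp (l * mart (S - {v}) \<omega>) \<partial>M)"
    using Suc.hyps(1) pc by blast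
  also have "\<dots> \<le> exp (l\<^sup>2 * (\<Sum>v\<in>S - {v}. (weight v)\<^sup>2) / 8) *
      (exp (l\<^sup>2 * (weight v)\<^sup>2 / 8) * (\<integral>\<omega>. exp (l * mart S \<omega>) \<partial>M))"
    using exp_moment_step[OF Suc.prems pc v assms(1)] by (intro mult_left_mono) auto
  also have "\<dots> = exp (l\<^sup>2 * (\<Sum>v\<in>S. (weight v)\<^sup>2) / 8) * (\<integral>\<omega>. exp (l * mart S \<omega>) \<partial>M)"
    using fin v by (simp add: sum.remove exp_add[symmetric] mult.assoc[symmetric] distrib_left add_divide_distrib add.commute)
  finally show ?case .
qed

lemma exp_moment:
  assumes "0 \<le> l"
  shows "(\<integral>\<omega>. exp (l * (f (X \<omega>) - expectation (\<lambda>\<omega>. f (X \<omega>)))) \<partial>M) \<le> exp (l\<^sup>2 * (\<Sum>v\<in>V. (weight v)\<^sup>2) / 8)"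
proof -
  let ?\<mu> = "expectation (\<lambda>\<omega>. f (X \<omega>))"
  have "par_closed V"
    using par by (auto simp: par_closed_def)
  then have "(\<integral>\<omega>. exp (l * f (X \<omega>)) \<partial>M) \<le>
      exp (l\<^sup>2 * (\<Sum>v\<in>V. (weight v)\<^sup>2) / 8) * (\<integral>\<omega>. exp (l * mart V \<omega>) \<partial>M)"
    by (rule exp_moment_par_closed[OF assms])
  also have "(\<integral>\<omega>. exp (l * mart V \<omega>) \<partial>M) = (\<integral>\<omega>. exp (l * ?\<mu>) \<partial>M)"
    using mart_V by (intro integral_cong_AE) (auto simp: mart_def)
  finally have "exp (- (l * ?\<mu>)) * (\<integral>\<omega>. exp (l * f (X \<omega>)) \<partial>M) \<le>
      exp (- (l * ?\<mu>)) * (exp (l\<^sup>2 * (\<Sum>v\<in>V. (weight v)\<^sup>2) / 8) * exp (l * ?\<mu>))"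
    by (intro mult_left_mono) (auto simp: prob_space)
  also have "\<dots> = exp (l\<^sup>2 * (\<Sum>v\<in>V. (weight v)\<^sup>2) / 8)"
    by (simp add: exp_minus field_simps)
  also have "exp (- (l * ?\<mu>)) * (\<integral>\<omega>. exp (l * f (X \<omega>)) \<partial>M) = (\<integral>\<omega>. exp (l * (f (X \<omega>) - ?\<mu>)) \<partial>M)"
    by (subst integral_mult_right_zero[symmetric]) (simp add: exp_add[symmetric] right_diff_distrib)
  finally show ?thesis .
qed

lemma tail_bound:
  assumes "0 < t"
  shows "prob {\<omega>\<in>space M. f (X \<omega>) - expectation (\<lambda>\<omega>. f (X \<omega>)) \<ge> t} \<le> exp_bound t (\<Sum>v\<in>V. (weight v)\<^sup>2)"
proof -
  let ?Y = "\<lambda>\<omega>. f (X \<omega>) - expectation (\<lambda>\<omega>. f (X \<omega>))" and ?D = "\<Sum>v\<in>V. (weight v)\<^sup>2"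
  have chernoff: "prob {\<omega>\<in>space M. ?Y \<omega> \<ge> t} \<le> exp (l\<^sup>2 * ?D / 8 - l * t)" if "0 < l" for l
  proof -
    obtain B where B: "\<forall>x\<in>space (Pi\<^sub>M V N). \<bar>f x\<bar> \<le> B"
      using f_bounded by blast
    have "integrable M (\<lambda>\<omega>. exp (l * ?Y \<omega>))"
    proof (rule integrable_const_bound)
      have "?Y \<omega> \<le> B - expectation (\<lambda>\<omega>. f (X \<omega>))" if "\<omega> \<in> space M" for \<omega>
        using B measurable_space[OF X that] by (auto simp: abs_le_iff)
      then show "AE \<omega> in M. norm (exp (l * ?Y \<omega>)) \<le> exp (l * (B - expectation (\<lambda>\<omega>. f (X \<omega>))))"
        using \<open>0 < l\<close> by (intro AE_I2) (simp add: mult_left_mono)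
    qed measurable
    then have "prob {\<omega>\<in>space M. exp (l * ?Y \<omega>) \<ge> exp (l * t)} \<le> (\<integral>\<omega>. exp (l * ?Y \<omega>) \<partial>M) / exp (l * t)"
      by (intro integral_Markov_inequality_measure[where A = "space M"]) auto
    also have "\<dots> \<le> exp (l\<^sup>2 * ?D / 8) / exp (l * t)"
      using exp_moment[of l] \<open>0 < l\<close> by (intro divide_right_mono) auto
    finally show ?thesis
      using \<open>0 < l\<close> by (simp add: exp_diff)
  qed
  show ?thesis
  proof (cases "?D = 0")
    case True
    \<comment> \<open>Without a quadratic term the Chernoff bound is exp(-t l) for all positive l,
      and letting l grow shows that the probability is 0, the value of \<open>exp_bound\<close> at
      0.\<close>
    have "((\<lambda>l. exp (- t * l)) \<longlongrightarrow> 0) at_top"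
      using \<open>0 < t\<close> by real_asymp
    moreover have "\<forall>\<^sub>F l in at_top. prob {\<omega>\<in>space M. ?Y \<omega> \<ge> t} \<le> exp (- t * l)"
      using eventually_gt_at_top[of 0]
    proof eventually_elim
      case (elim l)
      then show ?case
        using chernoff[of l] True by (simp add: mult.commute)
    qed
    ultimately have "prob {\<omega>\<in>space M. ?Y \<omega> \<ge> t} \<le> 0"
      by (rule tendsto_lowerbound) simp
    then show ?thesis
      using True by (simp add: exp_bound_def)
  next
    case False
    then have D: "0 < ?D"
      using sum_nonneg[of V "\<lambda>v. (weight v)\<^sup>2"] by simp
    \<comment> \<open>The minimiser of \<open>l\<^sup>2 * ?D / 8 - l * t\<close>.\<close>
    let ?l = "4 * t / ?D"
    have "prob {\<omega>\<in>space M. ?Y \<omega> \<ge> t} \<le> exp (?l\<^sup>2 * ?D / 8 - ?l * t)"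
      using D \<open>0 < t\<close> by (intro chernoff) simp
    also have "?l\<^sup>2 * ?D / 8 - ?l * t = - (2 * t\<^sup>2 / ?D)"
      using D by (simp add: field_simps power2_eq_square)
    finally show ?thesis
      using D by (simp add: exp_bound_def)
  qed
qed

end

section \<open>The bound for a forest with roots of minimal weight\<close>

theorem theorem2p2:
  fixes n k :: nat
    and \<Omega> :: "nat \<Rightarrow> 'a topology"
    and c :: "nat \<Rightarrow> real"
    and f :: "(nat \<Rightarrow> 'a) \<Rightarrow> real"
    and G :: "nat ugraph"
    and T :: "nat \<Rightarrow> nat ugraph"
    and M :: "'w measure"
    and X :: "'w \<Rightarrow> nat \<Rightarrow> 'a"
    and t :: real
  assumes "1 \<le> n"
    and "\<And>i. i \<in> {1..n} \<Longrightarrow> polish_topology (\<Omega> i)"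
    and "\<And>i. i \<in> {1..n} \<Longrightarrow> 0 \<le> c i"
    and "f \<in> borel_measurable (Pi\<^sub>M {1..n} (\<lambda>i. borel_of_topology (\<Omega> i)))"
    and "lipschitz_wrt {1..n} (\<lambda>i. topspace (\<Omega> i)) c f"
    and "simple_graph G" and "verts G = {1..n}"
    and "prob_space M"
    and "X \<in> measurable M (Pi\<^sub>M {1..n} (\<lambda>i. borel_of_topology (\<Omega> i)))"
    and "graph_dependent M G (\<lambda>i. borel_of_topology (\<Omega> i)) X"
    and "\<And>i. i \<in> {1..k} \<Longrightarrow> tree_graph (T i)"
    and "disjoint_union_of G {1..k} T"
    and "0 < t"
  shows "measure M {\<omega> \<in> space M. f (X \<omega>) - (\<integral>\<omega>'. f (X \<omega>') \<partial>M) \<ge> t}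
    \<le> exp_bound t ((\<Sum>i=1..k. (Min (c ` verts (T i)))\<^sup>2) + (\<Sum>e\<in>edges G. (\<Sum>j\<in>e. c j)\<^sup>2))"
proof -
  interpret prob_space M by fact
  let ?I = "{1..k}" and ?V = "{1..n}" and ?N = "\<lambda>i. borel_of_topology (\<Omega> i)"
  have vG: "?V = (\<Union>i\<in>?I. verts (T i))"
    and disj: "disjoint_family_on (\<lambda>i. verts (T i)) ?I"
    using assms(7,12) by (auto simp: disjoint_union_of_def)
  have "\<exists>r\<in>verts (T i). c r = Min (c ` verts (T i))" if "i \<in> ?I" for i
  proof -
    have "finite (verts (T i))" "verts (T i) \<noteq> {}"
      using assms(11)[OF that] by (auto simp: tree_graph_def simple_graph_def connected_graph_def)
    then have "Min (c ` verts (T i)) \<in> c ` verts (T i)"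
      by (intro Min_in) auto
    then show ?thesis
      by auto
  qed
  then obtain r where r: "\<And>i. i \<in> ?I \<Longrightarrow> r i \<in> verts (T i)" "\<And>i. i \<in> ?I \<Longrightarrow> c (r i) = Min (c ` verts (T i))"
    by metis
  let ?R = "r ` ?I"
  obtain par and rank :: "nat \<Rightarrow> nat" where
    par: "\<And>v. v \<in> ?V - ?R \<Longrightarrow> par v \<in> ?V \<and> rank (par v) < rank v"
    and edges: "edges G = (\<lambda>v. {v, par v}) ` (?V - ?R)"
    by (rule forest_rooting[of ?I T G r, OF assms(11,12) r(1), unfolded assms(7)]) (assumption | rule that)+
  interpret forest_dependent M ?V \<Omega> c f X ?R par rank ?N
  proof unfold_locales
    fix S T assume ST: "S \<subseteq> ?V" "T \<subseteq> ?V" "S \<inter> T = {}"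
      and nadj: "\<And>v. v \<in> ?V - ?R \<Longrightarrow> \<not> (v \<in> S \<and> par v \<in> T) \<and> \<not> (v \<in> T \<and> par v \<in> S)"
    \<comment> \<open>Every edge joins a vertex to its parent, so the absence of parent links
      between \<open>S\<close> and \<open>T\<close> in both directions is non-adjacency.\<close>
    have "nonadjacent G S T"
      unfolding nonadjacent_def edges using nadj by (fastforce simp: doubleton_eq_iff)
    then show "indep_var (Pi\<^sub>M S ?N) (\<lambda>\<omega>. restrict (X \<omega>) S) (Pi\<^sub>M T ?N) (\<lambda>\<omega>. restrict (X \<omega>) T)"
      using assms(10) ST unfolding graph_dependent_def assms(7) by blast
  qed (use assms(2-5,9) par in auto)
  have RV: "?R \<subseteq> ?V"
    using r(1) vG by auto
  \<comment> \<open>Distinct trees have distinct roots, so summing over roots is the same as summing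
    over trees.\<close>
  have inj: "inj_on r ?I"
  proof (intro inj_onI, rule ccontr)
    fix i j assume ij: "i \<in> ?I" "j \<in> ?I" "r i = r j" "i \<noteq> j"
    then have "verts (T i) \<inter> verts (T j) = {}"
      using disj by (intro disjoint_family_onD) auto
    then show False
      using r(1)[OF ij(1)] r(1)[OF ij(2)] ij(3) by auto
  qed
  have roots: "(\<Sum>v\<in>?R. (weight v)\<^sup>2) = (\<Sum>i=1..k. (Min (c ` verts (T i)))\<^sup>2)"
  proof (rule sum.reindex_cong[OF inj refl])
    fix i assume i: "i \<in> ?I"
    then have "weight (r i) = c (r i)"
      unfolding weight_def by (intro if_P imageI)
    then show "(weight (r i))\<^sup>2 = (Min (c ` verts (T i)))\<^sup>2"
      by (simp only: r(2)[OF i])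
  qed
  \<comment> \<open>Each edge is counted at its child end; \<open>rank\<close> excludes
    \<open>v = par v\<close>, so the inner sum has two terms.\<close>
  have "(\<Sum>e\<in>edges G. (\<Sum>j\<in>e. c j)\<^sup>2) = (\<Sum>v\<in>?V - ?R. (\<Sum>j\<in>{v, par v}. c j)\<^sup>2)"
    unfolding edges using par by (intro sum_parent_edges[where rank = rank]) auto
  also have "\<dots> = (\<Sum>v\<in>?V - ?R. (weight v)\<^sup>2)"
  proof (rule sum.cong[OF refl])
    fix v assume v: "v \<in> ?V - ?R"
    then have "v \<noteq> par v"
      using par[of v] by auto
    moreover have "weight v = c v + c (par v)"
      unfolding weight_def using v by (intro if_not_P) blast
    ultimately show "(\<Sum>j\<in>{v, par v}. c j)\<^sup>2 = (weight v)\<^sup>2"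
      by simp
  qed
  finally have "(\<Sum>i=1..k. (Min (c ` verts (T i)))\<^sup>2) + (\<Sum>e\<in>edges G. (\<Sum>j\<in>e. c j)\<^sup>2) = (\<Sum>v\<in>?V. (weight v)\<^sup>2)"
    unfolding roots[symmetric] using sum.subset_diff[OF RV, of "\<lambda>v. (weight v)\<^sup>2"] by simp
  then show ?thesis
    using tail_bound[OF assms(13)] by simp
qed

end
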